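(* Let $K:\mathbb{C}^m\times\mathbb{C}^m\to\mathbb{C}$ be a positive definite kernel with reproducing kernel Hilbert space $\mathcal{H}(K)$ and feature map $\Phi:\mathbb{C}^m\to\mathcal{H}(K)$. Let $X=(x_j)_{j=1}^n$ with $x_j\in\mathbb{C}^m$, and $\Phi(X)=[\Phi(x_1)\ \cdots\ \Phi(x_n)]$. Let $L:\mathcal{H}(K)\to\mathbb{C}^n$ be given by $Lf=\sum_{j=1}^n\langle\Phi(x_j),f\rangle_{\mathcal{H}(K)}\,\delta_j$, where $(\delta_j)$ is the standard orthonormal basis of $\mathbb{C}^n$, so that $$L^{*}L=\sum_{j=1}^n|\Phi(x_j)\rangle\langle\Phi(x_j)|=\Phi(X)\Phi(X)^{*},$$ and let $$G:=L^{*}L=\sum_j\lambda_j^{2}|\phi_j\rangle\langle\phi_j|$$ be the corresponding spectral representation, with $\lambda_1^{2}\ge\lambda_2^{2}\ge\cdots$. Then $$|\phi_1\rangle\langle\phi_1|=\operatorname{argmax}\left\{\|Q_1\Phi(X)\|_{HS}^{2}\;:\;\|Q_1\|_{HS}^{2}=1,\ Q_1=Q_1^{*}=Q_1^{2}\right\}$$ $$=\operatorname{argmax}\left\{\operatorname{tr}(Q_1G)\;:\;\|Q_1\|_{HS}^{2}=1\right\},$$ where in both cases $Q_1$ is a selfadjoint projection. Equivalently, the best rank-1 approximation to $G$ is $$\lambda_1^{2}|\phi_1\rangle\langle\phi_1|.$$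
   Context: A positive definite kernel on a set $S$ is a function $K:S\times S\to\mathbb{C}$ with $\sum_{i,j=1}^{N}\overline{c_i}c_jK(x_i,x_j)\ge 0$ for all $N\in\mathbb{N}$, $x_1,\dots,x_N\in S$, $c_1,\dots,c_N\in\mathbb{C}$. Inner products are conjugate linear in the first variable; $|u\rangle\langle v|$ denotes the rank-one operator $w\mapsto\langle v,w\rangle u$. $\mathcal{H}(K)$ is the Hilbert space of functions on $S$ obtained by completing $\mathrm{span}\{K(\cdot,x):x\in S\}$ in the inner product $\langle\sum c_iK(\cdot,x_i),\sum d_jK(\cdot,x_j)\rangle=\sum\overline{c_i}d_jK(x_i,x_j)$. A feature map is a map $\Phi:S\to\mathcal{H}(K)$ with $K(x,y)=\langle\Phi(x),\Phi(y)\rangle_{\mathcal{H}(K)}$ for all $x,y\in S$. $\Phi(X)$ acts as $c\mapsto\sum_{j=1}^n\Phi(x_j)c_j$ from $\mathbb{C}^n$ to $\mathcal{H}(K)$, and equals $L^{*}$. The $\phi_j$ are the orthonormal eigenvectors in the spectral representation of $G$. $\|A\|_{HS}^{2}=\operatorname{tr}(A^{*}A)$ is the squared Hilbert-Schmidt norm. $Q_1$ ranges over operators on $\mathcal{H}(K)$. The notation argmax stands for the data which realizes the optimization (here, the maximum). *)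

theory Defs
  imports "HOL-Analysis.Analysis" "HOL-Library.Function_Algebras"
begin

section \<open>Complex inner product spaces with explicit carriers\<close>

text \<open>
  The space \<open>H(K)\<close> depends on the kernel, so Hilbert spaces are carriers inside an ambient additive
  group, with their own scalar multiplication and inner product.  Inner products are conjugate
  linear in the first argument.  Operators are functions on the ambient type of which only the
  values on the carrier matter.
\<close>

record 'v ips =
  vecs :: "'v set"
  scal :: "complex \<Rightarrow> 'v \<Rightarrow> 'v"
  cip :: "'v \<Rightarrow> 'v \<Rightarrow> complex"

definition ips_norm :: "'v ips \<Rightarrow> 'v \<Rightarrow> real" where
  "ips_norm H f = sqrt (Re (cip H f f))"

definition bounded_op ::
    "'v::ab_group_add ips \<Rightarrow> 'w::ab_group_add ips \<Rightarrow> ('v \<Rightarrow> 'w) \<Rightarrow> bool" where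
  "bounded_op H1 H2 A \<longleftrightarrow>
     (\<forall>f\<in>vecs H1. A f \<in> vecs H2) \<and>
     (\<forall>f\<in>vecs H1. \<forall>g\<in>vecs H1. A (f + g) = A f + A g) \<and>
     (\<forall>a. \<forall>f\<in>vecs H1. A (scal H1 a f) = scal H2 a (A f)) \<and>
     (\<exists>M. \<forall>f\<in>vecs H1. ips_norm H2 (A f) \<le> M * ips_norm H1 f)"

definition op_eq :: "'v ips \<Rightarrow> ('v \<Rightarrow> 'w) \<Rightarrow> ('v \<Rightarrow> 'w) \<Rightarrow> bool" where
  "op_eq H A B \<longleftrightarrow> (\<forall>f\<in>vecs H. A f = B f)"

text \<open>The Hilbert space adjoint of \<open>A : H1 \<rightarrow> H2\<close>, as a map from \<open>H2\<close> to \<open>H1\<close>.\<close>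

definition adj :: "'v ips \<Rightarrow> 'w ips \<Rightarrow> ('v \<Rightarrow> 'w) \<Rightarrow> 'w \<Rightarrow> 'v" where
  "adj H1 H2 A g = (THE h. h \<in> vecs H1 \<and> (\<forall>f\<in>vecs H1. cip H1 h f = cip H2 g (A f)))"

text \<open>\<open>ketbra H u v\<close> is the rank-one operator \<open>|u\<rangle>\<langle>v|\<close>.\<close>

definition ketbra :: "'v ips \<Rightarrow> 'v \<Rightarrow> 'v \<Rightarrow> 'v \<Rightarrow> 'v" where
  "ketbra H u v = (\<lambda>w. scal H (cip H v w) u)"

definition rank_le_one :: "'v ips \<Rightarrow> 'w ips \<Rightarrow> ('v \<Rightarrow> 'w) \<Rightarrow> bool" where
  "rank_le_one H1 H2 A \<longleftrightarrow> (\<exists>u\<in>vecs H2. \<forall>f\<in>vecs H1. \<exists>a. A f = scal H2 a u)"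

definition orthonormal_basis :: "'v::ab_group_add ips \<Rightarrow> 'v set \<Rightarrow> bool" where
  "orthonormal_basis H B \<longleftrightarrow>
     B \<subseteq> vecs H \<and>
     (\<forall>e\<in>B. \<forall>e'\<in>B. cip H e e' = (if e = e' then 1 else 0)) \<and>
     (\<forall>f\<in>vecs H. \<forall>\<epsilon>>0. \<exists>F a. finite F \<and> F \<subseteq> B \<and>
        ips_norm H (f - (\<Sum>e\<in>F. scal H (a e) e)) < \<epsilon>)"

text \<open>
  The trace does not depend on the chosen orthonormal basis for trace class operators and for
  operators of the form \<open>A\<^sup>* A\<close>.  The basis may be uncountable.  A divergent sum has the value
  \<open>0\<close>; in particular \<open>hs_norm A = 1\<close> forces \<open>A\<close> to be Hilbert-Schmidt.
\<close>

definition op_trace :: "'v::ab_group_add ips \<Rightarrow> ('v \<Rightarrow> 'v) \<Rightarrow> complex" where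
  "op_trace H T = (\<Sum>\<^sub>\<infinity>e\<in>(SOME B. orthonormal_basis H B). cip H e (T e))"

definition hs_norm ::
    "'v::ab_group_add ips \<Rightarrow> 'w::ab_group_add ips \<Rightarrow> ('v \<Rightarrow> 'w) \<Rightarrow> real" where
  "hs_norm H1 H2 A = sqrt (Re (op_trace H1 (adj H1 H2 A \<circ> A)))"

text \<open>
  The real part in \<open>hs_norm\<close> is a coercion only: \<open>tr (A\<^sup>* A)\<close> is real and nonnegative.  Likewise
  \<open>tr (Q G)\<close> is real for a selfadjoint projection \<open>Q\<close> and a positive operator \<open>G\<close> of finite rank.
\<close>

definition selfadjoint_projection :: "'v::ab_group_add ips \<Rightarrow> ('v \<Rightarrow> 'v) \<Rightarrow> bool" where
  "selfadjoint_projection H Q \<longleftrightarrow>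
     bounded_op H H Q \<and> op_eq H Q (adj H H Q) \<and> op_eq H Q (Q \<circ> Q)"

definition Cn :: "(complex ^ 'n) ips" where
  "Cn = \<lparr>vecs = UNIV, scal = (*s), cip = (\<lambda>u v. \<Sum>j\<in>UNIV. cnj (u $ j) * v $ j)\<rparr>"


section \<open>Positive definite kernels and their Hilbert spaces\<close>

definition pos_def_kernel :: "('s \<Rightarrow> 's \<Rightarrow> complex) \<Rightarrow> bool" where
  "pos_def_kernel K \<longleftrightarrow>
     (\<forall>(N::nat) (x::nat \<Rightarrow> 's) (c::nat \<Rightarrow> complex).
        (\<Sum>i=1..N. \<Sum>j=1..N. cnj (c i) * c j * K (x i) (x j)) \<in> \<real>\<^sub>\<ge>\<^sub>0)"

text \<open>
  A finitely supported \<open>c\<close> encodes the element \<open>\<Sum>x. c x * K(\<cdot>,x)\<close> of the span of the kernel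
  sections; \<open>kernel_form\<close> is the inner product of two such elements.
\<close>

definition kernel_comb :: "('s \<Rightarrow> 's \<Rightarrow> complex) \<Rightarrow> ('s \<Rightarrow> complex) \<Rightarrow> 's \<Rightarrow> complex" where
  "kernel_comb K c = (\<lambda>y. \<Sum>x | c x \<noteq> 0. c x * K y x)"

definition kernel_form ::
    "('s \<Rightarrow> 's \<Rightarrow> complex) \<Rightarrow> ('s \<Rightarrow> complex) \<Rightarrow> ('s \<Rightarrow> complex) \<Rightarrow> complex" where
  "kernel_form K c d = (\<Sum>x | c x \<noteq> 0. \<Sum>y | d y \<noteq> 0. cnj (c x) * d y * K x y)"

text \<open>
  The completion is realised inside the functions on \<open>S\<close>: its elements are the pointwise limits
  of Cauchy sequences of the span.  Point evaluations on the span are inner products with kernel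
  sections, so Cauchy sequences do converge pointwise, and two of them have the same pointwise
  limit iff their difference tends to \<open>0\<close> in norm.
\<close>

definition represents ::
    "('s \<Rightarrow> 's \<Rightarrow> complex) \<Rightarrow> (nat \<Rightarrow> 's \<Rightarrow> complex) \<Rightarrow> ('s \<Rightarrow> complex) \<Rightarrow> bool" where
  "represents K c f \<longleftrightarrow>
     (\<forall>n. finite {x. c n x \<noteq> 0}) \<and>
     (\<forall>\<epsilon>>0. \<exists>M. \<forall>m\<ge>M. \<forall>n\<ge>M. sqrt (Re (kernel_form K (c m - c n) (c m - c n))) < \<epsilon>) \<and>
     (\<forall>y. (\<lambda>n. kernel_comb K (c n) y) \<longlonglongrightarrow> f y)"

definition rkhs :: "('s \<Rightarrow> 's \<Rightarrow> complex) \<Rightarrow> ('s \<Rightarrow> complex) ips" where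
  "rkhs K =
     \<lparr>vecs = {f. \<exists>c. represents K c f},
      scal = (\<lambda>a f y. a * f y),
      cip = (\<lambda>f g. THE z. \<forall>c d. represents K c f \<longrightarrow> represents K d g \<longrightarrow>
                     (\<lambda>n. kernel_form K (c n) (d n)) \<longlonglongrightarrow> z)\<rparr>"

definition feature_map ::
    "('s \<Rightarrow> 's \<Rightarrow> complex) \<Rightarrow> ('s \<Rightarrow> 's \<Rightarrow> complex) \<Rightarrow> bool" where
  "feature_map K \<Phi> \<longleftrightarrow>
     (\<forall>x. \<Phi> x \<in> vecs (rkhs K)) \<and> (\<forall>x y. K x y = cip (rkhs K) (\<Phi> x) (\<Phi> y))"


section \<open>The operators attached to a sample\<close>

text \<open>\<open>analysis_op\<close> is \<open>L\<close>, \<open>synthesis_op\<close> is \<open>\<Phi>(X)\<close> and \<open>frame_op\<close> is \<open>G = L\<^sup>* L\<close>.\<close>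

definition analysis_op ::
    "'v ips \<Rightarrow> ('s \<Rightarrow> 'v) \<Rightarrow> ('n::finite \<Rightarrow> 's) \<Rightarrow> 'v \<Rightarrow> complex ^ 'n" where
  "analysis_op H \<Phi> x f = (\<Sum>j\<in>UNIV. cip H (\<Phi> (x j)) f *s axis j 1)"

definition synthesis_op ::
    "'v::ab_group_add ips \<Rightarrow> ('s \<Rightarrow> 'v) \<Rightarrow> ('n::finite \<Rightarrow> 's) \<Rightarrow> complex ^ 'n \<Rightarrow> 'v" where
  "synthesis_op H \<Phi> x c = (\<Sum>j\<in>UNIV. scal H (c $ j) (\<Phi> (x j)))"

definition frame_op ::
    "'v::ab_group_add ips \<Rightarrow> ('s \<Rightarrow> 'v) \<Rightarrow> ('n::finite \<Rightarrow> 's) \<Rightarrow> 'v \<Rightarrow> 'v" where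
  "frame_op H \<Phi> x = adj H Cn (analysis_op H \<Phi> x) \<circ> analysis_op H \<Phi> x"

text \<open>
  \<open>G = \<Sum>j. \<lambda>\<^sub>j\<^sup>2 |\<phi>\<^sub>j\<rangle>\<langle>\<phi>\<^sub>j|\<close> for finitely or infinitely many indices
  \<open>1, 2, \<dots>\<close>, the sum converging in the norm of \<open>H\<close> at every vector.  The orthonormal family need
  not be complete, and eigenvalues \<open>0\<close> may be listed or omitted.
\<close>

definition index_set :: "enat \<Rightarrow> nat set" where
  "index_set N = {j. 1 \<le> j \<and> enat j \<le> N}"

definition spectral_representation ::
    "'v::ab_group_add ips \<Rightarrow> ('v \<Rightarrow> 'v) \<Rightarrow> enat \<Rightarrow> (nat \<Rightarrow> real) \<Rightarrow> (nat \<Rightarrow> 'v) \<Rightarrow> bool" where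
  "spectral_representation H G N lam \<phi> \<longleftrightarrow>
     (\<forall>j\<in>index_set N. \<phi> j \<in> vecs H) \<and>
     (\<forall>i\<in>index_set N. \<forall>j\<in>index_set N. cip H (\<phi> i) (\<phi> j) = (if i = j then 1 else 0)) \<and>
     (\<forall>i\<in>index_set N. \<forall>j\<in>index_set N. i \<le> j \<longrightarrow> (lam j)\<^sup>2 \<le> (lam i)\<^sup>2) \<and>
     (\<forall>f\<in>vecs H.
        ((\<lambda>F. ips_norm H
             (G f - (\<Sum>j\<in>F. scal H (of_real ((lam j)\<^sup>2)) (ketbra H (\<phi> j) (\<phi> j) f))))
          \<longlongrightarrow> 0) (finite_subsets_at_top (index_set N)))"

definition top_eigenvalue_simple :: "enat \<Rightarrow> (nat \<Rightarrow> real) \<Rightarrow> bool" where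
  "top_eigenvalue_simple N lam \<longleftrightarrow>
     0 < (lam 1)\<^sup>2 \<and> (\<forall>j\<in>index_set N. j \<noteq> 1 \<longrightarrow> (lam j)\<^sup>2 < (lam 1)\<^sup>2)"


section \<open>Argmax and argmin of functionals of operators\<close>

text \<open>
  ``A is the argmax (argmin)'' means that A realizes the optimum, and is the only operator to do
  so when the condition \<open>U\<close> holds.  Without a simple top eigenvalue there are several optimizers,
  of which \<open>|\<phi>\<^sub>1\<rangle>\<langle>\<phi>\<^sub>1|\<close> is one.
\<close>

definition realizes_max ::
    "'v ips \<Rightarrow> bool \<Rightarrow> (('v \<Rightarrow> 'v) \<Rightarrow> real) \<Rightarrow> (('v \<Rightarrow> 'v) \<Rightarrow> bool) \<Rightarrow> ('v \<Rightarrow> 'v) \<Rightarrow> bool" where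
  "realizes_max H U J P A \<longleftrightarrow>
     is_arg_max J P A \<and> (U \<longrightarrow> (\<forall>B. is_arg_max J P B \<longrightarrow> op_eq H B A))"

definition realizes_min ::
    "'v ips \<Rightarrow> bool \<Rightarrow> (('v \<Rightarrow> 'v) \<Rightarrow> real) \<Rightarrow> (('v \<Rightarrow> 'v) \<Rightarrow> bool) \<Rightarrow> ('v \<Rightarrow> 'v) \<Rightarrow> bool" where
  "realizes_min H U J P A \<longleftrightarrow>
     is_arg_min J P A \<and> (U \<longrightarrow> (\<forall>B. is_arg_min J P B \<longrightarrow> op_eq H B A))"

end

theory Submission
  imports Defs
begin

text \<open>
  The statement is about the Rayleigh quotient of \<open>G\<close>. A selfadjoint projection of Hilbert--Schmidt norm
  one is \<open>|q\<rangle>\<langle>q|\<close> for a unit vector \<open>q\<close> (\<open>projection_of_unit_hs_norm\<close>), and for it both functionals have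
  the value \<open>\<langle>q, G q\<rangle>\<close> (\<open>hs_norm_projected_synthesis\<close>, \<open>op_trace_projected_frame\<close>). The spectral representation
  bounds this number by \<open>\<lambda>\<^sub>1\<^sup>2\<close>; if the remaining eigenvalues are at most some \<open>\<mu> < \<lambda>\<^sub>1\<^sup>2\<close>, only the multiples of
  \<open>\<phi>\<^sub>1\<close> attain the bound (\<open>frame_form_gap\<close>, \<open>maximizer_unique\<close>).

  An operator of rank at most one is \<open>|u\<rangle>\<langle>v|\<close> with a unit vector \<open>u\<close>, and its squared distance from \<open>G\<close> is
  \<open>|G|\<^sup>2 - |G u|\<^sup>2 + |v - G u|\<^sup>2\<close> (\<open>hs_norm_frame_op_diff_ketbra\<close>). The optimal \<open>v\<close> is \<open>G u\<close>, and
  \<open>|G u|\<^sup>2 \<le> \<lambda>\<^sub>1\<^sup>2 \<langle>u, G u\<rangle>\<close> (\<open>nrm_frame_op_sq_le\<close>) leads back to the Rayleigh quotient.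

  All of this takes place in an arbitrary Hilbert space. The sums that define traces run over a chosen
  orthonormal basis, whose existence is proved by Zorn's lemma, and adjoints exist by the Riesz
  representation theorem; both rest on completeness through \<open>orthogonal_projection\<close>. What remains is that
  the pointwise limits of Cauchy sequences of kernel combinations do form a Hilbert space
  (\<open>hilbert_space_rkhs\<close>). The point there is that a Cauchy sequence of combinations that tends to zero
  pointwise, hence weakly, tends to zero in norm, so that the limit of the kernel forms depends on the
  limit functions alone.
\<close>

section \<open>Inner product spaces on explicit carriers\<close>

lemma mult_cnj_norm: "cnj z * z = of_real ((cmod z)\<^sup>2)" "z * cnj z = of_real ((cmod z)\<^sup>2)"
  by (simp_all add: complex_norm_square mult.commute flip: of_real_power)

text \<open>
  Positivity without definiteness: the finite combinations of kernel sections form such a space, since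
  a nonzero combination may be the zero function. The Cauchy--Schwarz inequality and the calculus of
  Cauchy sequences already hold here, so they serve the construction of \<open>H(K)\<close> as well as \<open>H(K)\<close> itself.
\<close>

locale semi_inner_space =
  fixes H :: "'v::ab_group_add ips"
  assumes zero_vecs [simp]: "0 \<in> vecs H"
    and add_vecs [simp]: "f \<in> vecs H \<Longrightarrow> g \<in> vecs H \<Longrightarrow> f + g \<in> vecs H"
    and scal_vecs [simp]: "f \<in> vecs H \<Longrightarrow> scal H a f \<in> vecs H"
    and scal_add_right: "f \<in> vecs H \<Longrightarrow> g \<in> vecs H \<Longrightarrow> scal H a (f + g) = scal H a f + scal H a g"
    and scal_add_left: "f \<in> vecs H \<Longrightarrow> scal H (a + b) f = scal H a f + scal H b f"
    and scal_scal [simp]: "f \<in> vecs H \<Longrightarrow> scal H a (scal H b f) = scal H (a * b) f"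
    and scal_one [simp]: "f \<in> vecs H \<Longrightarrow> scal H 1 f = f"
    and cip_add_right: "f \<in> vecs H \<Longrightarrow> g \<in> vecs H \<Longrightarrow> h \<in> vecs H \<Longrightarrow> cip H f (g + h) = cip H f g + cip H f h"
    and cip_scal_right: "f \<in> vecs H \<Longrightarrow> g \<in> vecs H \<Longrightarrow> cip H f (scal H a g) = a * cip H f g"
    and cnj_cip: "f \<in> vecs H \<Longrightarrow> g \<in> vecs H \<Longrightarrow> cnj (cip H f g) = cip H g f"
    and Re_cip_nonneg: "f \<in> vecs H \<Longrightarrow> 0 \<le> Re (cip H f f)"
begin

abbreviation nrm :: "'v \<Rightarrow> real" where "nrm \<equiv> ips_norm H"

lemma scal_zero_left [simp]: "f \<in> vecs H \<Longrightarrow> scal H 0 f = 0"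
  using scal_add_left[of f 0 0] by simp

lemma scal_zero_right [simp]: "scal H a 0 = 0"
  using scal_add_right[of 0 0 a] by simp

lemma scal_minus_left: "f \<in> vecs H \<Longrightarrow> scal H (- a) f = - scal H a f"
  using scal_add_left[of f a "- a"] by (simp add: eq_neg_iff_add_eq_0 add.commute)

lemma uminus_vecs [simp]: "f \<in> vecs H \<Longrightarrow> - f \<in> vecs H"
  using scal_minus_left[of f 1] scal_vecs[of f "- 1"] by simp

lemma diff_vecs [simp]: "f \<in> vecs H \<Longrightarrow> g \<in> vecs H \<Longrightarrow> f - g \<in> vecs H"
  using add_vecs[of f "- g"] by simp

lemma scal_minus_right: "f \<in> vecs H \<Longrightarrow> scal H a (- f) = - scal H a f"
  using scal_add_right[of f "- f" a] by (simp add: eq_neg_iff_add_eq_0 add.commute)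

lemma scal_diff_right: "f \<in> vecs H \<Longrightarrow> g \<in> vecs H \<Longrightarrow> scal H a (f - g) = scal H a f - scal H a g"
  using scal_add_right[of f "- g" a] by (simp add: scal_minus_right)

lemma sum_vecs [simp]: "(\<And>i. i \<in> I \<Longrightarrow> f i \<in> vecs H) \<Longrightarrow> sum f I \<in> vecs H"
  by (induction I rule: infinite_finite_induct) auto

lemma scal_sum_right: "(\<And>i. i \<in> I \<Longrightarrow> f i \<in> vecs H) \<Longrightarrow> scal H a (sum f I) = (\<Sum>i\<in>I. scal H a (f i))"
  by (induction I rule: infinite_finite_induct) (auto simp: scal_add_right)

lemma cip_add_left:
  "f \<in> vecs H \<Longrightarrow> g \<in> vecs H \<Longrightarrow> h \<in> vecs H \<Longrightarrow> cip H (f + g) h = cip H f h + cip H g h"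
  by (metis add_vecs cip_add_right cnj_cip complex_cnj_add)

lemma cip_scal_left: "f \<in> vecs H \<Longrightarrow> g \<in> vecs H \<Longrightarrow> cip H (scal H a f) g = cnj a * cip H f g"
  by (metis scal_vecs cip_scal_right cnj_cip complex_cnj_mult)

lemma cip_zero_right [simp]: "f \<in> vecs H \<Longrightarrow> cip H f 0 = 0"
  using cip_add_right[of f 0 0] by simp

lemma cip_zero_left [simp]: "f \<in> vecs H \<Longrightarrow> cip H 0 f = 0"
  using cip_add_left[of 0 0 f] by simp

lemma cip_minus_right: "f \<in> vecs H \<Longrightarrow> g \<in> vecs H \<Longrightarrow> cip H f (- g) = - cip H f g"
  using cip_add_right[of f g "- g"] by (simp add: eq_neg_iff_add_eq_0 add.commute)

lemma cip_minus_left: "f \<in> vecs H \<Longrightarrow> g \<in> vecs H \<Longrightarrow> cip H (- f) g = - cip H f g"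
  using cip_add_left[of f "- f" g] by (simp add: eq_neg_iff_add_eq_0 add.commute)

lemma cip_diff_right:
  "f \<in> vecs H \<Longrightarrow> g \<in> vecs H \<Longrightarrow> h \<in> vecs H \<Longrightarrow> cip H f (g - h) = cip H f g - cip H f h"
  using cip_add_right[of f g "- h"] by (simp add: cip_minus_right)

lemma cip_diff_left:
  "f \<in> vecs H \<Longrightarrow> g \<in> vecs H \<Longrightarrow> h \<in> vecs H \<Longrightarrow> cip H (f - g) h = cip H f h - cip H g h"
  using cip_add_left[of f "- g" h] by (simp add: cip_minus_left)

lemmas cip_lin = cip_add_right cip_add_left cip_scal_right cip_scal_left cip_diff_right cip_diff_left

lemma cip_sum_right:
  "f \<in> vecs H \<Longrightarrow> (\<And>i. i \<in> I \<Longrightarrow> g i \<in> vecs H) \<Longrightarrow> cip H f (sum g I) = (\<Sum>i\<in>I. cip H f (g i))"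
  by (induction I rule: infinite_finite_induct) (auto simp: cip_add_right)

lemma cip_sum_left:
  "f \<in> vecs H \<Longrightarrow> (\<And>i. i \<in> I \<Longrightarrow> g i \<in> vecs H) \<Longrightarrow> cip H (sum g I) f = (\<Sum>i\<in>I. cip H (g i) f)"
  by (induction I rule: infinite_finite_induct) (auto simp: cip_add_left)

lemma nrm_nonneg [simp]: "f \<in> vecs H \<Longrightarrow> 0 \<le> nrm f"
  by (simp add: ips_norm_def Re_cip_nonneg)

lemma nrm_sq: "f \<in> vecs H \<Longrightarrow> (nrm f)\<^sup>2 = Re (cip H f f)"
  by (simp add: ips_norm_def Re_cip_nonneg)

lemma cip_self: "f \<in> vecs H \<Longrightarrow> cip H f f = of_real ((nrm f)\<^sup>2)"
  using cnj_cip[of f f] by (simp add: nrm_sq complex_eq_iff)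

lemma nrm_zero [simp]: "nrm 0 = 0"
  by (simp add: ips_norm_def)

lemma nrm_scal: "f \<in> vecs H \<Longrightarrow> nrm (scal H a f) = cmod a * nrm f"
proof -
  assume f: "f \<in> vecs H"
  have "cip H (scal H a f) (scal H a f) = (cnj a * a) * cip H f f"
    using f by (simp add: cip_scal_left cip_scal_right)
  then have "cip H (scal H a f) (scal H a f) = of_real ((cmod a * nrm f)\<^sup>2)"
    by (simp add: mult_cnj_norm cip_self[OF f] power_mult_distrib)
  then have "Re (cip H (scal H a f) (scal H a f)) = (cmod a * nrm f)\<^sup>2" by simp
  then show ?thesis using f by (simp add: ips_norm_def abs_mult Re_cip_nonneg)
qed

lemma nrm_minus: "f \<in> vecs H \<Longrightarrow> nrm (- f) = nrm f"
  using nrm_scal[of f "- 1"] by (simp add: scal_minus_left)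

lemma nrm_minus_commute: "f \<in> vecs H \<Longrightarrow> g \<in> vecs H \<Longrightarrow> nrm (f - g) = nrm (g - f)"
  using nrm_minus[of "f - g"] by simp

text \<open>
  Subtracting a real multiple \<open>t\<close> of \<open>\<langle>g, f\<rangle> g\<close> from \<open>f\<close> makes the squared norm a real quadratic polynomial in
  \<open>t\<close>. Its nonnegativity is the Cauchy--Schwarz inequality; \<open>t = 1\<close> with a unit vector \<open>g\<close> is Pythagoras, and
  \<open>t = 1/|g|\<^sup>2\<close> gives the best approximation along \<open>g\<close>.
\<close>

lemma nrm_sq_diff_scal:
  assumes "f \<in> vecs H" "g \<in> vecs H"
  shows "(nrm (f - scal H (of_real t * cip H g f) g))\<^sup>2
    = (nrm f)\<^sup>2 - 2 * t * (cmod (cip H g f))\<^sup>2 + t\<^sup>2 * (cmod (cip H g f))\<^sup>2 * (nrm g)\<^sup>2"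
proof -
  define b where "b = cip H g f"
  have b': "cip H f g = cnj b" using assms cnj_cip by (simp add: b_def)
  have "cip H (f - scal H (of_real t * b) g) (f - scal H (of_real t * b) g)
    = of_real ((nrm f)\<^sup>2) - of_real (2 * t) * (cnj b * b) + of_real (t\<^sup>2) * (cnj b * b) * of_real ((nrm g)\<^sup>2)"
    using assms by (simp add: cip_lin cip_self[OF assms(1)] cip_self[OF assms(2)] b' flip: b_def)
      (simp add: algebra_simps power2_eq_square)
  also have "\<dots> = of_real ((nrm f)\<^sup>2 - 2 * t * (cmod b)\<^sup>2 + t\<^sup>2 * (cmod b)\<^sup>2 * (nrm g)\<^sup>2)"
    by (simp add: mult_cnj_norm)
  finally show ?thesis using assms by (simp add: nrm_sq flip: b_def)
qed

lemma Cauchy_Schwarz: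
  assumes "f \<in> vecs H" "g \<in> vecs H"
  shows "cmod (cip H f g) \<le> nrm f * nrm g"
proof -
  define b where "b = (cmod (cip H f g))\<^sup>2"
  have pos: "0 \<le> (nrm g)\<^sup>2 - 2 * t * b + t\<^sup>2 * b * (nrm f)\<^sup>2" for t
    using nrm_sq_diff_scal[of g f t] assms unfolding b_def by (metis zero_le_power2)
  have "b \<le> (nrm f * nrm g)\<^sup>2"
  proof (cases "nrm f = 0")
    case True
    have "b = 0"
    proof (rule ccontr)
      assume b: "b \<noteq> 0"
      \<comment> \<open>A polynomial of degree one in t with nonzero slope becomes negative somewhere.\<close>
      show False using pos[of "((nrm g)\<^sup>2 + 1) / (2 * b)"] True b by simp
    qed
    then show ?thesis by simp
  next
    case False
    have "0 \<le> (nrm g)\<^sup>2 - b / (nrm f)\<^sup>2"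
      using pos[of "1 / (nrm f)\<^sup>2"] False by (simp add: power2_eq_square field_simps)
    then show ?thesis using False by (simp add: field_simps power_mult_distrib)
  qed
  then show ?thesis unfolding b_def by (rule power2_le_imp_le) (use assms in auto)
qed

lemma nrm_triangle:
  assumes "f \<in> vecs H" "g \<in> vecs H"
  shows "nrm (f + g) \<le> nrm f + nrm g"
proof -
  have "(nrm (f + g))\<^sup>2 = (nrm f)\<^sup>2 + (nrm g)\<^sup>2 + 2 * Re (cip H f g)"
    using assms cnj_cip[of f g] by (simp add: nrm_sq cip_lin flip: cnj_cip[of f g])
  also have "Re (cip H f g) \<le> nrm f * nrm g"
    using Cauchy_Schwarz[OF assms] complex_Re_le_cmod order_trans by blast
  finally have "(nrm (f + g))\<^sup>2 \<le> (nrm f + nrm g)\<^sup>2"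
    by (simp add: power2_sum)
  then show ?thesis using assms by (intro power2_le_imp_le[of "nrm (f + g)"]) auto
qed

lemma nrm_triangle_diff:
  assumes "f \<in> vecs H" "g \<in> vecs H" "h \<in> vecs H"
  shows "nrm (f - h) \<le> nrm (f - g) + nrm (g - h)"
proof -
  have "nrm ((f - g) + (g - h)) \<le> nrm (f - g) + nrm (g - h)"
    by (intro nrm_triangle diff_vecs assms)
  then show ?thesis by simp
qed

lemma nrm_sq_diff:
  assumes "f \<in> vecs H" "g \<in> vecs H"
  shows "(nrm (f - g))\<^sup>2 = (nrm f)\<^sup>2 - 2 * Re (cip H f g) + (nrm g)\<^sup>2"
  using assms cnj_cip[of f g, symmetric] by (simp add: nrm_sq cip_diff_left cip_diff_right)

lemma tendsto_cip_right:
  assumes "f \<in> vecs H" "\<And>n. X n \<in> vecs H" "g \<in> vecs H" "((\<lambda>n. nrm (X n - g)) \<longlongrightarrow> 0) F"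
  shows "((\<lambda>n. cip H f (X n)) \<longlongrightarrow> cip H f g) F"
proof -
  have "((\<lambda>n. cip H f (X n) - cip H f g) \<longlongrightarrow> 0) F"
  proof (rule Lim_null_comparison)
    show "\<forall>\<^sub>F n in F. norm (cip H f (X n) - cip H f g) \<le> nrm f * nrm (X n - g)"
      using assms Cauchy_Schwarz by (intro always_eventually allI) (simp flip: cip_diff_right)
    show "((\<lambda>n. nrm f * nrm (X n - g)) \<longlongrightarrow> 0) F"
      using tendsto_mult_right_zero[OF assms(4)] by blast
  qed
  then show ?thesis by (simp add: LIM_zero_cancel)
qed

text \<open>
  Completeness and the construction of \<open>H(K)\<close> are both phrased by Cauchy sequences in the seminorm, which
  have to stay inside the carrier.
\<close>

definition cauchy_seq :: "(nat \<Rightarrow> 'v) \<Rightarrow> bool" where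
  "cauchy_seq X \<longleftrightarrow> (\<forall>n. X n \<in> vecs H) \<and>
     (\<forall>\<epsilon>>0. \<exists>M. \<forall>m\<ge>M. \<forall>n\<ge>M. nrm (X m - X n) < \<epsilon>)"

lemma cauchy_seq_vecs: "cauchy_seq X \<Longrightarrow> X n \<in> vecs H"
  by (simp add: cauchy_seq_def)

lemma cauchy_seqD:
  assumes "cauchy_seq X" "\<epsilon> > 0"
  obtains M where "\<And>m n. m \<ge> M \<Longrightarrow> n \<ge> M \<Longrightarrow> nrm (X m - X n) < \<epsilon>"
  using assms unfolding cauchy_seq_def by metis

lemma cauchy_seq_const: "f \<in> vecs H \<Longrightarrow> cauchy_seq (\<lambda>_. f)"
  by (simp add: cauchy_seq_def)

lemma cauchy_seq_add:
  assumes X: "cauchy_seq X" and Y: "cauchy_seq Y"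
  shows "cauchy_seq (\<lambda>n. X n + Y n)"
  unfolding cauchy_seq_def
proof (intro conjI allI impI)
  note mem = cauchy_seq_vecs[OF X] cauchy_seq_vecs[OF Y]
  show "X n + Y n \<in> vecs H" for n using mem by simp
  fix \<epsilon> :: real assume "\<epsilon> > 0"
  then have e: "\<epsilon> / 2 > 0" by simp
  obtain M where M: "\<And>m n. m \<ge> M \<Longrightarrow> n \<ge> M \<Longrightarrow> nrm (X m - X n) < \<epsilon> / 2"
    using cauchy_seqD[OF X e] by metis
  obtain M' where M': "\<And>m n. m \<ge> M' \<Longrightarrow> n \<ge> M' \<Longrightarrow> nrm (Y m - Y n) < \<epsilon> / 2"
    using cauchy_seqD[OF Y e] by metis
  have "nrm (X m + Y m - (X n + Y n)) < \<epsilon>" if "m \<ge> max M M'" "n \<ge> max M M'" for m n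
  proof -
    have "nrm ((X m - X n) + (Y m - Y n)) \<le> nrm (X m - X n) + nrm (Y m - Y n)"
      using mem by (intro nrm_triangle diff_vecs)
    then have "nrm (X m + Y m - (X n + Y n)) \<le> nrm (X m - X n) + nrm (Y m - Y n)"
      by (simp only: add_diff_add)
    then show ?thesis using M[of m n] M'[of m n] that by simp
  qed
  then show "\<exists>M. \<forall>m\<ge>M. \<forall>n\<ge>M. nrm (X m + Y m - (X n + Y n)) < \<epsilon>" by blast
qed

lemma cauchy_seq_scal:
  assumes X: "cauchy_seq X"
  shows "cauchy_seq (\<lambda>n. scal H a (X n))"
  unfolding cauchy_seq_def
proof (intro conjI allI impI)
  note mem = cauchy_seq_vecs[OF X]
  show "scal H a (X n) \<in> vecs H" for n using mem by simp
  fix \<epsilon> :: real assume "\<epsilon> > 0"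
  have pos: "cmod a + 1 > 0" by (rule add_nonneg_pos) auto
  then have "\<epsilon> / (cmod a + 1) > 0" using \<open>\<epsilon> > 0\<close> by simp
  then obtain M where M: "\<And>m n. m \<ge> M \<Longrightarrow> n \<ge> M \<Longrightarrow> nrm (X m - X n) < \<epsilon> / (cmod a + 1)"
    using cauchy_seqD[OF X] by metis
  have "nrm (scal H a (X m) - scal H a (X n)) < \<epsilon>" if "m \<ge> M" "n \<ge> M" for m n
  proof -
    have "nrm (scal H a (X m) - scal H a (X n)) = cmod a * nrm (X m - X n)"
      using mem by (simp add: nrm_scal flip: scal_diff_right)
    also have "\<dots> \<le> (cmod a + 1) * nrm (X m - X n)" using mem by (intro mult_right_mono) auto
    also have "\<dots> < \<epsilon>" using M[OF that] pos by (simp add: pos_less_divide_eq mult.commute)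
    finally show ?thesis .
  qed
  then show "\<exists>M. \<forall>m\<ge>M. \<forall>n\<ge>M. nrm (scal H a (X m) - scal H a (X n)) < \<epsilon>" by blast
qed

lemma cauchy_seq_diff:
  assumes X: "cauchy_seq X" and Y: "cauchy_seq Y"
  shows "cauchy_seq (\<lambda>n. X n - Y n)"
  using cauchy_seq_add[OF X cauchy_seq_scal[OF Y, of "- 1"]] cauchy_seq_vecs[OF Y]
  by (simp add: scal_minus_left)

lemma cauchy_seq_bounded:
  assumes X: "cauchy_seq X"
  obtains C where "C > 0" "\<And>n. nrm (X n) \<le> C"
proof -
  note mem = cauchy_seq_vecs[OF X]
  obtain M where M: "\<And>m n. m \<ge> M \<Longrightarrow> n \<ge> M \<Longrightarrow> nrm (X m - X n) < 1"
    using cauchy_seqD[OF X zero_less_one] by metis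
  define C where "C = Max ((\<lambda>n. nrm (X n)) ` {..M}) + 1"
  have le: "nrm (X n) \<le> C - 1" if "n \<le> M" for n
    unfolding C_def using that by (auto intro!: Max_ge)
  have "nrm (X n) \<le> C" for n
  proof (cases "n \<le> M")
    case True
    then show ?thesis using le[of n] by simp
  next
    case False
    have "nrm (X n) \<le> nrm (X n - X M) + nrm (X M)"
      using nrm_triangle[of "X n - X M" "X M"] mem by simp
    then show ?thesis using M[of n M] le[of M] False by simp
  qed
  moreover have "C > 0" using le[of 0] nrm_nonneg[OF mem[of 0]] by simp
  ultimately show ?thesis using that by blast
qed

lemma cauchy_seq_cip_null:
  assumes X: "cauchy_seq X" and Y: "cauchy_seq Y" and null: "(\<lambda>n. nrm (X n)) \<longlonglongrightarrow> 0"
  shows "(\<lambda>n. cip H (X n) (Y n)) \<longlonglongrightarrow> 0"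
proof -
  note mem = cauchy_seq_vecs[OF X] cauchy_seq_vecs[OF Y]
  obtain C where C: "C > 0" "\<And>n. nrm (Y n) \<le> C" using cauchy_seq_bounded[OF Y] by metis
  show ?thesis
  proof (rule Lim_null_comparison)
    have "norm (cip H (X n) (Y n)) \<le> nrm (X n) * C" for n
      using Cauchy_Schwarz[OF mem(1)[of n] mem(2)[of n]] mult_left_mono[OF C(2)[of n] nrm_nonneg[OF mem(1)[of n]]]
      by linarith
    then show "\<forall>\<^sub>F n in sequentially. norm (cip H (X n) (Y n)) \<le> nrm (X n) * C" by simp
    show "(\<lambda>n. nrm (X n) * C) \<longlonglongrightarrow> 0" using null by (rule tendsto_mult_left_zero)
  qed
qed

lemma cauchy_seq_cip_convergent:
  assumes X: "cauchy_seq X" and Y: "cauchy_seq Y"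
  shows "convergent (\<lambda>n. cip H (X n) (Y n))"
proof -
  note mem = cauchy_seq_vecs[OF X] cauchy_seq_vecs[OF Y]
  obtain C where C: "C > 0" "\<And>n. nrm (X n) \<le> C" using cauchy_seq_bounded[OF X] by metis
  obtain D where D: "D > 0" "\<And>n. nrm (Y n) \<le> D" using cauchy_seq_bounded[OF Y] by metis
  have "Cauchy (\<lambda>n. cip H (X n) (Y n))"
  proof (rule CauchyI)
    fix e :: real assume "e > 0"
    then have e: "e / (2 * D) > 0" "e / (2 * C) > 0" using C D by simp_all
    obtain M where M: "\<And>m n. m \<ge> M \<Longrightarrow> n \<ge> M \<Longrightarrow> nrm (X m - X n) < e / (2 * D)"
      using cauchy_seqD[OF X e(1)] by metis
    obtain M' where M': "\<And>m n. m \<ge> M' \<Longrightarrow> n \<ge> M' \<Longrightarrow> nrm (Y m - Y n) < e / (2 * C)"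
      using cauchy_seqD[OF Y e(2)] by metis
    have "norm (cip H (X m) (Y m) - cip H (X n) (Y n)) < e"
      if mn: "m \<ge> max M M'" "n \<ge> max M M'" for m n
    proof -
      have "cip H (X m) (Y m) - cip H (X n) (Y n)
          = cip H (X m - X n) (Y m) + cip H (X n) (Y m - Y n)"
        using mem by (simp add: cip_diff_left cip_diff_right)
      also have "norm \<dots> \<le> nrm (X m - X n) * nrm (Y m) + nrm (X n) * nrm (Y m - Y n)"
        using mem by (intro order_trans[OF norm_triangle_ineq] add_mono Cauchy_Schwarz) auto
      also have "\<dots> \<le> nrm (X m - X n) * D + C * nrm (Y m - Y n)"
        using mem C D by (intro add_mono mult_left_mono mult_right_mono) auto
      also have "\<dots> < e / (2 * D) * D + C * (e / (2 * C))"
        using M[of m n] M'[of m n] mn C D by (intro add_strict_mono mult_strict_right_mono mult_strict_left_mono) auto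
      also have "\<dots> = e" using C D by simp
      finally show ?thesis .
    qed
    then show "\<exists>M. \<forall>m\<ge>M. \<forall>n\<ge>M. norm (cip H (X m) (Y m) - cip H (X n) (Y n)) < e" by blast
  qed
  then show ?thesis by (simp add: Cauchy_convergent_iff)
qed

text \<open>
  On a Cauchy sequence weak and strong convergence to zero agree: \<open>|X n|\<^sup>2\<close> differs from \<open>\<langle>X M, X n\<rangle>\<close> by at
  most \<open>|X n - X M| |X n|\<close>, which is small uniformly in \<open>n\<close> once \<open>M\<close> is large, and for this fixed \<open>M\<close> the
  inner product tends to zero. This is what makes the inner product of \<open>H(K)\<close> independent of the
  approximating sequences.
\<close>

lemma cauchy_seq_weakly_null:
  assumes X: "cauchy_seq X" and weak: "\<And>g. g \<in> vecs H \<Longrightarrow> (\<lambda>n. cip H g (X n)) \<longlonglongrightarrow> 0"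
  shows "(\<lambda>n. nrm (X n)) \<longlonglongrightarrow> 0"
proof -
  note mem = cauchy_seq_vecs[OF X]
  obtain C where C: "C > 0" "\<And>n. nrm (X n) \<le> C" using cauchy_seq_bounded[OF X] by metis
  have "(\<lambda>n. (nrm (X n))\<^sup>2) \<longlonglongrightarrow> 0"
  proof (rule LIMSEQ_I)
    fix e :: real assume "e > 0"
    then have e: "e / (2 * C) > 0" using C by simp
    obtain M where M: "\<And>m n. m \<ge> M \<Longrightarrow> n \<ge> M \<Longrightarrow> nrm (X m - X n) < e / (2 * C)"
      using cauchy_seqD[OF X e] by metis
    have "e / 2 > 0" using \<open>e > 0\<close> by simp
    then obtain N where N: "\<And>n. n \<ge> N \<Longrightarrow> cmod (cip H (X M) (X n)) < e / 2"
      using LIMSEQ_D[OF weak[OF mem[of M]]] by fastforce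
    have "(nrm (X n))\<^sup>2 < e" if "n \<ge> max M N" for n
    proof -
      have "(nrm (X n))\<^sup>2 = Re (cip H (X n - X M) (X n)) + Re (cip H (X M) (X n))"
        using mem by (simp add: nrm_sq cip_diff_left)
      also have "\<dots> \<le> nrm (X n - X M) * nrm (X n) + cmod (cip H (X M) (X n))"
        using mem by (intro add_mono order_trans[OF complex_Re_le_cmod Cauchy_Schwarz] complex_Re_le_cmod) auto
      also have "\<dots> < e / (2 * C) * C + e / 2"
      proof (intro add_le_less_mono)
        show "nrm (X n - X M) * nrm (X n) \<le> e / (2 * C) * C"
          using M[of n M] C that mem e by (intro mult_mono) auto
      qed (use N that in auto)
      also have "\<dots> = e" using C by simp
      finally show ?thesis .
    qed
    then show "\<exists>no. \<forall>n\<ge>no. norm ((nrm (X n))\<^sup>2 - 0) < e"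
      by (intro exI[of _ "max M N"]) simp
  qed
  from tendsto_real_sqrt[OF this] show ?thesis using mem by simp
qed

end

locale inner_space = semi_inner_space +
  assumes cip_definite: "f \<in> vecs H \<Longrightarrow> cip H f f = 0 \<Longrightarrow> f = 0"
begin

lemma nrm_eq_0_iff: "f \<in> vecs H \<Longrightarrow> nrm f = 0 \<longleftrightarrow> f = 0"
  using cip_definite[of f] cip_self[of f] by auto

lemma cip_ext:
  assumes "f \<in> vecs H" "g \<in> vecs H" "\<And>h. h \<in> vecs H \<Longrightarrow> cip H f h = cip H g h"
  shows "f = g"
  using cip_definite[of "f - g"] assms by (simp add: cip_lin)

lemma adj_eqI:
  assumes "h \<in> vecs H" "\<And>f. f \<in> vecs H \<Longrightarrow> cip H h f = cip H2 g (A f)"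
  shows "adj H H2 A g = h"
  unfolding adj_def
proof (rule the_equality)
  fix k assume "k \<in> vecs H \<and> (\<forall>f\<in>vecs H. cip H k f = cip H2 g (A f))"
  then show "k = h" using assms cip_ext[of k h] by simp
qed (use assms in auto)

text \<open>
  Completing the square: among all combinations of a finite orthonormal set the distance to \<open>f\<close> is
  smallest for the Fourier coefficients. Bessel's inequality and the Parseval identity are both read
  off from this formula.
\<close>

lemma bessel_expand:
  assumes "finite F" "F \<subseteq> vecs H" "\<And>e e'. e \<in> F \<Longrightarrow> e' \<in> F \<Longrightarrow> cip H e e' = (if e = e' then 1 else 0)"
    and f: "f \<in> vecs H"
  shows "(nrm (f - (\<Sum>e\<in>F. scal H (a e) e)))\<^sup>2 =
    (nrm f)\<^sup>2 - (\<Sum>e\<in>F. (cmod (cip H e f))\<^sup>2) + (\<Sum>e\<in>F. (cmod (a e - cip H e f))\<^sup>2)"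
proof -
  have mem: "\<And>e. e \<in> F \<Longrightarrow> e \<in> vecs H" using assms by auto
  let ?s = "\<Sum>e\<in>F. scal H (a e) e"
  have es: "cip H e ?s = a e" if "e \<in> F" for e
  proof -
    have "cip H e ?s = (\<Sum>e'\<in>F. a e' * (if e = e' then 1 else 0))"
      using that mem assms(3) by (subst cip_sum_right) (auto simp: cip_lin intro!: sum.cong)
    also have "\<dots> = (\<Sum>e'\<in>F. if e = e' then a e' else 0)" by (intro sum.cong) auto
    also have "\<dots> = a e" using that assms(1) by simp
    finally show ?thesis .
  qed
  have ss: "(nrm ?s)\<^sup>2 = (\<Sum>e\<in>F. (cmod (a e))\<^sup>2)"
  proof -
    have "cip H ?s ?s = (\<Sum>e\<in>F. cnj (a e) * a e)"
      using mem es by (subst cip_sum_left) (auto simp: cip_scal_left intro!: sum.cong)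
    then show ?thesis using mem by (simp add: nrm_sq mult_cnj_norm)
  qed
  have fs: "cip H f ?s = (\<Sum>e\<in>F. a e * cnj (cip H e f))"
    using mem f by (subst cip_sum_right) (auto simp: cip_lin cnj_cip)
  have pt: "(cmod (a e - cip H e f))\<^sup>2 = (cmod (a e))\<^sup>2 - 2 * Re (a e * cnj (cip H e f)) + (cmod (cip H e f))\<^sup>2" for e
    by (simp add: cmod_power2) (simp add: power2_eq_square algebra_simps)
  have "(nrm (f - ?s))\<^sup>2 = (nrm f)\<^sup>2 - 2 * Re (cip H f ?s) + (nrm ?s)\<^sup>2"
    using mem f by (intro nrm_sq_diff) auto
  also have "\<dots> = (nrm f)\<^sup>2 - (\<Sum>e\<in>F. (cmod (cip H e f))\<^sup>2) +
      (\<Sum>e\<in>F. (cmod (a e))\<^sup>2 - 2 * Re (a e * cnj (cip H e f)) + (cmod (cip H e f))\<^sup>2)"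
    unfolding fs ss Re_sum sum.distrib sum_subtractf sum_distrib_left by simp
  finally show ?thesis by (simp only: pt)
qed

lemma bessel_inequality:
  assumes "finite F" "\<And>j. j \<in> F \<Longrightarrow> \<phi> j \<in> vecs H"
    "\<And>i j. i \<in> F \<Longrightarrow> j \<in> F \<Longrightarrow> cip H (\<phi> i) (\<phi> j) = (if i = j then 1 else 0)" and f: "f \<in> vecs H"
  shows "(\<Sum>j\<in>F. (cmod (cip H (\<phi> j) f))\<^sup>2) \<le> (nrm f)\<^sup>2"
proof -
  have inj: "inj_on \<phi> F"
    using assms(3) by (metis (no_types, lifting) inj_on_def zero_neq_one)
  have "(nrm (f - (\<Sum>e\<in>\<phi> ` F. scal H (cip H e f) e)))\<^sup>2
      = (nrm f)\<^sup>2 - (\<Sum>e\<in>\<phi> ` F. (cmod (cip H e f))\<^sup>2)"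
    using assms inj by (subst bessel_expand) (auto simp: inj_on_eq_iff)
  also have "(\<Sum>e\<in>\<phi> ` F. (cmod (cip H e f))\<^sup>2) = (\<Sum>j\<in>F. (cmod (cip H (\<phi> j) f))\<^sup>2)"
    using inj by (simp add: sum.reindex)
  finally have "0 \<le> (nrm f)\<^sup>2 - (\<Sum>j\<in>F. (cmod (cip H (\<phi> j) f))\<^sup>2)"
    by (metis zero_le_power2)
  then show ?thesis by simp
qed

text \<open>
  The Fourier sum over a finite set that contains a good approximating set \<open>F\<close> is at least as good as any
  combination over \<open>F\<close>, so the partial sums converge along the net of all finite subsets of a possibly
  uncountable \<open>B\<close>.
\<close>

lemma parseval:
  assumes B: "orthonormal_basis H B" and f: "f \<in> vecs H" and g: "g \<in> vecs H"
  shows "((\<lambda>e. cip H f e * cip H e g) has_sum cip H f g) B"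
  unfolding has_sum_def tendsto_iff eventually_finite_subsets_at_top
proof (intro allI impI)
  fix \<epsilon> :: real assume "\<epsilon> > 0"
  define \<delta> where "\<delta> = \<epsilon> / (nrm f + 1)"
  have pos: "nrm f + 1 > 0" using f nrm_nonneg[of f] by linarith
  then have "\<delta> > 0" using \<open>\<epsilon> > 0\<close> by (simp add: \<delta>_def)
  then obtain F a where F: "finite F" "F \<subseteq> B" and lt: "nrm (g - (\<Sum>e\<in>F. scal H (a e) e)) < \<delta>"
    using B g unfolding orthonormal_basis_def by blast
  have BH: "B \<subseteq> vecs H" and on: "\<And>e e'. e \<in> B \<Longrightarrow> e' \<in> B \<Longrightarrow> cip H e e' = (if e = e' then 1 else 0)"
    using B unfolding orthonormal_basis_def by auto
  show "\<exists>X. finite X \<and> X \<subseteq> B \<and> (\<forall>Y. finite Y \<and> X \<subseteq> Y \<and> Y \<subseteq> B \<longrightarrow>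
      dist (\<Sum>e\<in>Y. cip H f e * cip H e g) (cip H f g) < \<epsilon>)"
  proof (intro exI[of _ F] conjI allI impI F)
    fix Y assume Y: "finite Y \<and> F \<subseteq> Y \<and> Y \<subseteq> B"
    let ?p = "\<Sum>e\<in>Y. scal H (cip H e g) e"
    have mem: "\<And>e. e \<in> Y \<Longrightarrow> e \<in> vecs H" using Y BH by auto
    have ex: "(nrm (g - (\<Sum>e\<in>Y. scal H (b e) e)))\<^sup>2 =
        (nrm g)\<^sup>2 - (\<Sum>e\<in>Y. (cmod (cip H e g))\<^sup>2) + (\<Sum>e\<in>Y. (cmod (b e - cip H e g))\<^sup>2)" for b
      by (rule bessel_expand) (use Y on g mem in \<open>blast+\<close>)
    \<comment> \<open>Extend the approximation on F by zero coefficients to Y.\<close>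
    define b where "b e = (if e \<in> F then a e else 0)" for e
    have "(\<Sum>e\<in>Y. scal H (b e) e) = (\<Sum>e\<in>F. scal H (a e) e)"
      using Y mem by (intro sum.mono_neutral_cong_right) (auto simp: b_def)
    then have "(nrm (g - ?p))\<^sup>2 \<le> (nrm (g - (\<Sum>e\<in>F. scal H (a e) e)))\<^sup>2"
      using ex[of b] ex[of "\<lambda>e. cip H e g"] by (simp add: sum_nonneg)
    then have "nrm (g - ?p) \<le> nrm (g - (\<Sum>e\<in>F. scal H (a e) e))"
      by (rule power2_le_imp_le) (use g mem F Y in \<open>auto intro!: nrm_nonneg diff_vecs sum_vecs scal_vecs\<close>)
    then have lt': "nrm (g - ?p) < \<delta>" using lt by simp
    have "(\<Sum>e\<in>Y. cip H f e * cip H e g) = cip H f ?p"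
      using mem f by (subst cip_sum_right) (auto simp: cip_lin mult.commute)
    then have "dist (\<Sum>e\<in>Y. cip H f e * cip H e g) (cip H f g) = cmod (cip H f (g - ?p))"
      using f g mem by (simp add: dist_norm norm_minus_commute cip_diff_right)
    also have "\<dots> \<le> nrm f * nrm (g - ?p)"
      using f g mem by (intro Cauchy_Schwarz) auto
    also have "\<dots> \<le> nrm f * \<delta>"
      using f lt' by (intro mult_left_mono) auto
    also have "\<dots> < \<epsilon>"
      using pos \<open>\<epsilon> > 0\<close> by (simp add: \<delta>_def field_simps)
    finally show "dist (\<Sum>e\<in>Y. cip H f e * cip H e g) (cip H f g) < \<epsilon>" .
  qed
qed

end

section \<open>Completeness: projections, Riesz representation, orthonormal bases\<close>

locale hilbert_space = inner_space +
  assumes complete: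
    "cauchy_seq X \<Longrightarrow> \<exists>l\<in>vecs H. (\<lambda>n. nrm (X n - l)) \<longlonglongrightarrow> 0"
begin

text \<open>
  The closest point argument, carried out in the closure of \<open>S\<close>: a minimizing sequence is Cauchy because
  almost minimal remainders are almost orthogonal to \<open>S\<close>. It is applied to the kernel of a functional
  (Riesz representation) and to the span of a maximal orthonormal set (existence of a basis).
\<close>

lemma orthogonal_projection:
  assumes S: "S \<subseteq> vecs H" "0 \<in> S" "\<And>g h. g \<in> S \<Longrightarrow> h \<in> S \<Longrightarrow> g + h \<in> S"
      "\<And>a g. g \<in> S \<Longrightarrow> scal H a g \<in> S"
    and f: "f \<in> vecs H"
  obtains s p where "\<And>n. s n \<in> S" "p \<in> vecs H" "(\<lambda>n. nrm (s n - p)) \<longlonglongrightarrow> 0"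
    "\<And>g. g \<in> S \<Longrightarrow> cip H g (f - p) = 0"
proof -
  have SH: "\<And>g. g \<in> S \<Longrightarrow> g \<in> vecs H" using S by auto
  define d where "d = (INF g\<in>S. (nrm (f - g))\<^sup>2)"
  have bdd: "bdd_below ((\<lambda>g. (nrm (f - g))\<^sup>2) ` S)" by (intro bdd_belowI[of _ 0]) auto
  have d_le: "d \<le> (nrm (f - g))\<^sup>2" if "g \<in> S" for g
    unfolding d_def using bdd that by (rule cINF_lower)
  have "\<exists>g\<in>S. (nrm (f - g))\<^sup>2 < d + 1 / real (Suc n)" for n
    using cINF_less_iff[OF _ bdd, of "d + 1 / real (Suc n)"] S(2) unfolding d_def by auto
  then obtain s where s: "\<And>n. s n \<in> S" and sd: "\<And>n. (nrm (f - s n))\<^sup>2 < d + 1 / real (Suc n)"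
    by metis
  note sH = SH[OF s]
  define \<eta> where "\<eta> n = sqrt (1 / real (Suc n))" for n
  \<comment> \<open>Almost minimality makes the remainder almost orthogonal to S.\<close>
  have orth: "cmod (cip H g (f - s n)) \<le> nrm g * \<eta> n" if g: "g \<in> S" for g n
  proof (cases "nrm g = 0")
    case True
    then show ?thesis using Cauchy_Schwarz[of g "f - s n"] g SH sH f by simp
  next
    case False
    let ?b = "cip H g (f - s n)" and ?t = "1 / (nrm g)\<^sup>2"
    have "d \<le> (nrm (f - s n - scal H (of_real ?t * ?b) g))\<^sup>2"
      using d_le[OF S(3)[OF s[of n] S(4)[OF g, of "of_real ?t * ?b"]]] by (simp add: diff_diff_eq)
    also have "\<dots> = (nrm (f - s n))\<^sup>2 - (cmod ?b)\<^sup>2 / (nrm g)\<^sup>2"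
      using f sH SH[OF g] False by (subst nrm_sq_diff_scal) (auto simp: power2_eq_square field_simps)
    finally have "(cmod ?b)\<^sup>2 / (nrm g)\<^sup>2 \<le> 1 / real (Suc n)" using sd[of n] by linarith
    then have "(cmod ?b)\<^sup>2 \<le> (nrm g)\<^sup>2 * (1 / real (Suc n))"
      using False by (subst (asm) pos_divide_le_eq) (auto simp: mult.commute)
    also have "\<dots> = (nrm g * \<eta> n)\<^sup>2" by (simp add: \<eta>_def power_mult_distrib)
    finally show ?thesis by (rule power2_le_imp_le) (use SH[OF g] in \<open>auto simp: \<eta>_def\<close>)
  qed
  have \<eta>0: "\<eta> \<longlonglongrightarrow> 0"
    unfolding \<eta>_def using tendsto_real_sqrt[OF LIMSEQ_inverse_real_of_nat] by (simp add: inverse_eq_divide)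
  have diffS: "s m - s n \<in> S" for m n
    using S(3)[OF s[of m] S(4)[OF s[of n], of "- 1"]] sH[of n] by (simp add: scal_minus_left)
  \<comment> \<open>The difference of two members lies in S, and both remainders are almost orthogonal to it.\<close>
  have dist_s: "nrm (s m - s n) \<le> \<eta> m + \<eta> n" for m n
  proof -
    let ?g = "s m - s n"
    have "(nrm ?g)\<^sup>2 = Re (cip H ?g (f - s n) - cip H ?g (f - s m))"
      using sH f by (simp add: nrm_sq flip: cip_diff_right)
    also have "\<dots> \<le> cmod (cip H ?g (f - s n)) + cmod (cip H ?g (f - s m))"
      by (metis complex_Re_le_cmod norm_triangle_ineq4 order_trans)
    also have "\<dots> \<le> nrm ?g * (\<eta> m + \<eta> n)"
      using orth[OF diffS, of m n m] orth[OF diffS, of m n n] by (simp add: distrib_left)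
    finally have "nrm ?g * nrm ?g \<le> nrm ?g * (\<eta> m + \<eta> n)" by (simp add: power2_eq_square)
    moreover have "0 \<le> nrm ?g" "0 \<le> \<eta> m + \<eta> n" using sH by (simp_all add: \<eta>_def)
    ultimately show ?thesis by (metis mult_le_cancel_left_pos order_le_less)
  qed
  have "\<exists>M. \<forall>m\<ge>M. \<forall>n\<ge>M. nrm (s m - s n) < \<epsilon>" if "\<epsilon> > 0" for \<epsilon>
  proof -
    obtain M where M: "\<And>n. n \<ge> M \<Longrightarrow> \<eta> n < \<epsilon> / 2"
      using order_tendstoD(2)[OF \<eta>0, of "\<epsilon> / 2"] \<open>\<epsilon> > 0\<close> half_gt_zero
      unfolding eventually_sequentially by blast
    have "nrm (s m - s n) < \<epsilon>" if "m \<ge> M" "n \<ge> M" for m n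
      using dist_s[of m n] M[OF that(1)] M[OF that(2)] by linarith
    then show ?thesis by blast
  qed
  then obtain p where p: "p \<in> vecs H" and lim: "(\<lambda>n. nrm (s n - p)) \<longlonglongrightarrow> 0"
    using complete[of s] sH unfolding cauchy_seq_def by blast
  have "cip H g (f - p) = 0" if g: "g \<in> S" for g
  proof (rule LIMSEQ_unique)
    have "(\<lambda>n. cip H g f - cip H g (s n)) \<longlonglongrightarrow> cip H g f - cip H g p"
      using SH[OF g] sH p lim by (intro tendsto_intros tendsto_cip_right)
    then show "(\<lambda>n. cip H g (f - s n)) \<longlonglongrightarrow> cip H g (f - p)"
      using SH[OF g] sH p f by (simp add: cip_diff_right)
    have "(\<lambda>n. nrm g * \<eta> n) \<longlonglongrightarrow> 0" using \<eta>0 by (rule tendsto_mult_right_zero)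
    then show "(\<lambda>n. cip H g (f - s n)) \<longlonglongrightarrow> 0"
      by (rule Lim_null_comparison[rotated]) (use orth[OF g] in auto)
  qed
  with s p lim show ?thesis by (rule that)
qed

text \<open>
  A nonzero vector orthogonal to the kernel of a nonzero bounded functional represents it up to a scalar, since every
  vector differs from a multiple of it by an element of the kernel.
\<close>

lemma riesz_representation:
  assumes add: "\<And>f g. f \<in> vecs H \<Longrightarrow> g \<in> vecs H \<Longrightarrow> a (f + g) = a f + a g"
    and hom: "\<And>c f. f \<in> vecs H \<Longrightarrow> a (scal H c f) = c * a f"
    and bound: "\<And>f. f \<in> vecs H \<Longrightarrow> cmod (a f) \<le> M * nrm f"
  obtains h where "h \<in> vecs H" "\<And>f. f \<in> vecs H \<Longrightarrow> a f = cip H h f"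
proof (cases "\<forall>f\<in>vecs H. a f = 0")
  case True
  show ?thesis by (rule that[of 0]) (use True in auto)
next
  case False
  then obtain f where f: "f \<in> vecs H" "a f \<noteq> 0" by blast
  have diff: "a (g - h) = a g - a h" if "g \<in> vecs H" "h \<in> vecs H" for g h
    using add[of "g - h" h] that by simp
  define S where "S = {g \<in> vecs H. a g = 0}"
  have a0: "a 0 = 0" using add[of 0 0] by simp
  obtain s p where s: "\<And>n. s n \<in> S" and p: "p \<in> vecs H" and lim: "(\<lambda>n. nrm (s n - p)) \<longlonglongrightarrow> 0"
    and orth: "\<And>g. g \<in> S \<Longrightarrow> cip H g (f - p) = 0"
    by (rule orthogonal_projection[of S f]) (use f in \<open>auto simp: S_def add hom a0\<close>)
  have "a p = 0"
  proof -
    have "(\<lambda>n. a (s n - p)) \<longlonglongrightarrow> 0"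
    proof (rule Lim_null_comparison)
      show "\<forall>\<^sub>F n in sequentially. norm (a (s n - p)) \<le> M * nrm (s n - p)"
        using s p by (intro always_eventually allI bound) (auto simp: S_def)
      show "(\<lambda>n. M * nrm (s n - p)) \<longlonglongrightarrow> 0" using lim by (rule tendsto_mult_right_zero)
    qed
    moreover have "a (s n - p) = - a p" for n using s[of n] p diff by (auto simp: S_def)
    ultimately show ?thesis by (simp add: LIMSEQ_const_iff)
  qed
  define h where "h = f - p"
  have h: "h \<in> vecs H" "a h = a f" using f p diff \<open>a p = 0\<close> by (auto simp: h_def)
  have "h \<noteq> 0" using h f a0 by auto
  then have n0: "cip H h h \<noteq> 0" using h cip_definite by blast
  show ?thesis
  proof (rule that)
    show "scal H (cnj (a h / cip H h h)) h \<in> vecs H" using h by simp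
    fix g assume g: "g \<in> vecs H"
    have "a (g - scal H (a g / a h) h) = 0"
      using g h f by (simp add: diff hom)
    then have "cip H (g - scal H (a g / a h) h) h = 0"
      using g h by (intro orth[folded h_def]) (auto simp: S_def)
    then have "cip H h (g - scal H (a g / a h) h) = 0"
      using g h cnj_cip[of "g - scal H (a g / a h) h" h] by simp
    then have "cip H h g = (a g / a h) * cip H h h"
      using g h by (simp add: cip_lin)
    then show "a g = cip H (scal H (cnj (a h / cip H h h)) h) g"
      using g h f n0 by (simp add: cip_lin)
  qed
qed

text \<open>
  The adjoint is defined by a definite description, so its characteristic property is available only
  once the representing vector is known to exist.
\<close>

lemma adj_bounded_op:
  assumes A: "bounded_op H H A" and g: "g \<in> vecs H"
  shows "adj H H A g \<in> vecs H" "\<And>f. f \<in> vecs H \<Longrightarrow> cip H (adj H H A g) f = cip H g (A f)"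
proof -
  obtain M where M: "\<And>f. f \<in> vecs H \<Longrightarrow> nrm (A f) \<le> M * nrm f"
    using A unfolding bounded_op_def by blast
  have AH: "\<And>f. f \<in> vecs H \<Longrightarrow> A f \<in> vecs H" using A unfolding bounded_op_def by blast
  obtain h where h: "h \<in> vecs H" "\<And>f. f \<in> vecs H \<Longrightarrow> cip H g (A f) = cip H h f"
  proof (rule riesz_representation[of "\<lambda>f. cip H g (A f)" "nrm g * M"])
    fix f assume f: "f \<in> vecs H"
    have "cmod (cip H g (A f)) \<le> nrm g * nrm (A f)" using f g AH Cauchy_Schwarz by simp
    also have "\<dots> \<le> nrm g * (M * nrm f)" using f g M by (intro mult_left_mono) auto
    finally show "cmod (cip H g (A f)) \<le> nrm g * M * nrm f" by simp
  qed (use A g in \<open>auto simp: bounded_op_def cip_lin\<close>)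
  have "adj H H A g = h" using h by (intro adj_eqI) auto
  then show "adj H H A g \<in> vecs H" "\<And>f. f \<in> vecs H \<Longrightarrow> cip H (adj H H A g) f = cip H g (A f)"
    using h by auto
qed

text \<open>
  Zorn's lemma gives a maximal orthonormal set. If its span were not dense, normalising the remainder of
  an orthogonal projection would enlarge it. Traces and Hilbert--Schmidt norms are sums over a chosen
  basis, so they carry information only because of this lemma.
\<close>

lemma orthonormal_basis_exists: "\<exists>B. orthonormal_basis H B"
proof -
  define on where "on B \<longleftrightarrow> B \<subseteq> vecs H \<and> (\<forall>e\<in>B. \<forall>e'\<in>B. cip H e e' = (if e = e' then 1 else 0))" for B
  have "\<exists>B\<in>{B. on B}. \<forall>X\<in>{B. on B}. B \<subseteq> X \<longrightarrow> X = B"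
  proof (rule subset_Zorn')
    fix C assume C: "subset.chain {B. on B} C"
    have C': "\<And>b. b \<in> C \<Longrightarrow> on b" "\<And>b c. b \<in> C \<Longrightarrow> c \<in> C \<Longrightarrow> b \<subseteq> c \<or> c \<subseteq> b"
      using C by (auto simp: subset_chain_def)
    have "cip H e e' = (if e = e' then 1 else 0)"
      if e: "e \<in> b" "b \<in> C" "e' \<in> c" "c \<in> C" for e e' b c
    proof -
      obtain d where "d \<in> C" "e \<in> d" "e' \<in> d" using C'(2) e by blast
      then show ?thesis using C'(1) unfolding on_def by blast
    qed
    then show "\<Union>C \<in> {B. on B}" using C'(1) unfolding on_def by blast
  qed
  then obtain B where B: "on B" and max: "\<And>X. on X \<Longrightarrow> B \<subseteq> X \<Longrightarrow> X = B" by blast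
  have BH: "\<And>e. e \<in> B \<Longrightarrow> e \<in> vecs H" using B by (auto simp: on_def)
  define S where "S = {\<Sum>e\<in>F. scal H (a e) e |F a. finite F \<and> F \<subseteq> B}"
  have Sadd: "g + h \<in> S" if gh: "g \<in> S" "h \<in> S" for g h
  proof -
    obtain F a where g: "g = (\<Sum>e\<in>F. scal H (a e) e)" "finite F" "F \<subseteq> B" using gh S_def by auto
    obtain F' b where h: "h = (\<Sum>e\<in>F'. scal H (b e) e)" "finite F'" "F' \<subseteq> B" using gh S_def by auto
    let ?a = "\<lambda>e. if e \<in> F then a e else 0" and ?b = "\<lambda>e. if e \<in> F' then b e else 0"
    have "g = (\<Sum>e\<in>F \<union> F'. scal H (?a e) e)" unfolding g
      using g h BH by (intro sum.mono_neutral_cong_left) auto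
    moreover have "h = (\<Sum>e\<in>F \<union> F'. scal H (?b e) e)" unfolding h
      using g h BH by (intro sum.mono_neutral_cong_left) auto
    moreover have "(\<Sum>e\<in>F \<union> F'. scal H (?a e + ?b e) e) =
        (\<Sum>e\<in>F \<union> F'. scal H (?a e) e + scal H (?b e) e)"
      using g h BH by (intro sum.cong refl scal_add_left) auto
    ultimately have "g + h = (\<Sum>e\<in>F \<union> F'. scal H (?a e + ?b e) e)"
      by (simp only: sum.distrib)
    moreover have "finite (F \<union> F')" "F \<union> F' \<subseteq> B" using g h by auto
    ultimately show ?thesis unfolding S_def by (intro CollectI exI[of _ "F \<union> F'"]
        exI[of _ "\<lambda>e. ?a e + ?b e"]) simp
  qed
  have Sscal: "scal H c g \<in> S" if g: "g \<in> S" for c g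
  proof -
    obtain F a where g: "g = (\<Sum>e\<in>F. scal H (a e) e)" "finite F" "F \<subseteq> B" using g S_def by auto
    have "scal H c g = (\<Sum>e\<in>F. scal H (c * a e) e)"
      unfolding g using g BH by (subst scal_sum_right) (auto intro!: sum.cong)
    then show ?thesis unfolding S_def using g(2,3) by (intro CollectI exI[of _ F]
        exI[of _ "\<lambda>e. c * a e"]) simp
  qed
  have BS: "B \<subseteq> S"
  proof
    fix e assume e: "e \<in> B"
    then have "e = (\<Sum>e\<in>{e}. scal H 1 e)" using BH by simp
    then show "e \<in> S" unfolding S_def using e by (intro CollectI exI[of _ "{e}"] exI[of _ "\<lambda>_. 1"]) auto
  qed
  have dense: "\<exists>F a. finite F \<and> F \<subseteq> B \<and> nrm (f - (\<Sum>e\<in>F. scal H (a e) e)) < \<epsilon>"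
    if f: "f \<in> vecs H" and "\<epsilon> > 0" for f and \<epsilon> :: real
  proof -
    have S: "S \<subseteq> vecs H" "0 \<in> S"
    proof -
      show "S \<subseteq> vecs H" unfolding S_def using BH by (auto intro!: sum_vecs)
      show "0 \<in> S" unfolding S_def by (intro CollectI exI[of _ "{}"]) auto
    qed
    obtain s p where s: "\<And>n. s n \<in> S" and p: "p \<in> vecs H" and lim: "(\<lambda>n. nrm (s n - p)) \<longlonglongrightarrow> 0"
      and orth: "\<And>g. g \<in> S \<Longrightarrow> cip H g (f - p) = 0"
      using orthogonal_projection[of S f, OF S Sadd Sscal f] by blast
    have "f = p"
    proof (rule ccontr)
      assume "f \<noteq> p"
      then have n0: "nrm (f - p) \<noteq> 0" using f p nrm_eq_0_iff[of "f - p"] by simp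
      define r where "r = scal H (of_real (1 / nrm (f - p))) (f - p)"
      have r: "r \<in> vecs H" using f p by (simp add: r_def)
      have r1: "cip H r r = 1"
      proof -
        have "nrm r = 1" using f p n0 by (simp add: r_def nrm_scal norm_divide)
        then show ?thesis using cip_self[OF r] by simp
      qed
      have rB: "cip H e r = 0" "cip H r e = 0" if "e \<in> B" for e
      proof -
        have "cip H e (f - p) = 0" using that BS orth by blast
        then show 1: "cip H e r = 0" using that BH f p by (simp add: r_def cip_scal_right)
        show "cip H r e = 0" using 1 cnj_cip[of e r] that BH r by simp
      qed
      have "on (insert r B)" using B r r1 rB unfolding on_def by auto
      then have "r \<in> B" using max by blast
      then show False using rB r1 by auto
    qed
    have "\<forall>\<^sub>F n in sequentially. nrm (s n - p) < \<epsilon>" using lim \<open>\<epsilon> > 0\<close> by (rule order_tendstoD)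
    then obtain n where "nrm (s n - p) < \<epsilon>" using eventually_happens' sequentially_bot by blast
    moreover have "s n \<in> vecs H" using s S by auto
    ultimately have "nrm (f - s n) < \<epsilon>" using \<open>f = p\<close> f by (simp add: nrm_minus_commute)
    moreover obtain F a where "s n = (\<Sum>e\<in>F. scal H (a e) e)" "finite F" "F \<subseteq> B"
      using s[of n] unfolding S_def by blast
    ultimately show ?thesis by metis
  qed
  show ?thesis using B dense unfolding orthonormal_basis_def on_def by blast
qed

end

section \<open>The reproducing kernel Hilbert space\<close>

text \<open>
  The space to be completed: finitely supported coefficient functions, with the kernel form as a
  possibly degenerate inner product.
\<close>

definition kernel_combs :: "('s \<Rightarrow> 's \<Rightarrow> complex) \<Rightarrow> ('s \<Rightarrow> complex) ips" where
  "kernel_combs K = \<lparr>vecs = {c. finite {x. c x \<noteq> 0}}, scal = (\<lambda>a c x. a * c x), cip = kernel_form K\<rparr>"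

lemma kernel_combs_simps [simp]:
  "c \<in> vecs (kernel_combs K) \<longleftrightarrow> finite {x. c x \<noteq> 0}"
  "scal (kernel_combs K) a c = (\<lambda>x. a * c x)"
  "cip (kernel_combs K) = kernel_form K"
  by (simp_all add: kernel_combs_def)

lemma rkhs_simps:
  "f \<in> vecs (rkhs K) \<longleftrightarrow> (\<exists>c. represents K c f)"
  "scal (rkhs K) a f = (\<lambda>y. a * f y)"
  by (simp_all add: rkhs_def)

text \<open>
  Summing over any finite sets that contain the supports turns additivity of the form into
  additivity of sums over a fixed index set.
\<close>

lemma kernel_form_superset:
  assumes "finite A" "finite B" "{x. c x \<noteq> 0} \<subseteq> A" "{x. d x \<noteq> 0} \<subseteq> B"
  shows "kernel_form K c d = (\<Sum>x\<in>A. \<Sum>y\<in>B. cnj (c x) * d y * K x y)"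
proof -
  have "kernel_form K c d = (\<Sum>x | c x \<noteq> 0. \<Sum>y\<in>B. cnj (c x) * d y * K x y)"
    unfolding kernel_form_def using assms
    by (intro sum.cong refl sum.mono_neutral_left) auto
  also have "\<dots> = (\<Sum>x\<in>A. \<Sum>y\<in>B. cnj (c x) * d y * K x y)"
    using assms by (intro sum.mono_neutral_left) auto
  finally show ?thesis .
qed

lemma kernel_form_comb: "kernel_form K c d = (\<Sum>x | c x \<noteq> 0. cnj (c x) * kernel_comb K d x)"
  unfolding kernel_form_def kernel_comb_def by (simp add: sum_distrib_left mult.assoc)

locale positive_definite_kernel =
  fixes K :: "'s \<Rightarrow> 's \<Rightarrow> complex"
  assumes pos_def: "pos_def_kernel K"
begin

lemma finite_form_nonneg:
  assumes "finite S"
  shows "(\<Sum>x\<in>S. \<Sum>y\<in>S. cnj (c x) * c y * K x y) \<in> \<real>\<^sub>\<ge>\<^sub>0"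
proof -
  obtain h where h: "bij_betw h {1..card S} S" using ex_bij_betw_nat_finite_1[OF assms] by blast
  have "(\<Sum>x\<in>S. \<Sum>y\<in>S. cnj (c x) * c y * K x y)
      = (\<Sum>i=1..card S. \<Sum>j=1..card S. cnj (c (h i)) * c (h j) * K (h i) (h j))"
    by (simp only: sum.reindex_bij_betw[OF h, symmetric])
  then show ?thesis using pos_def unfolding pos_def_kernel_def by simp
qed

text \<open>
  Nonnegativity is required of complex quadratic forms, and the coefficients \<open>(1, 1)\<close> and \<open>(1, \<i>)\<close> on two
  points already force the symmetry.
\<close>

lemma hermitian: "K y x = cnj (K x y)"
proof (cases "x = y")
  case True
  then show ?thesis
    using finite_form_nonneg[of "{x}" "\<lambda>_. 1"] by (simp add: complex_nonneg_Reals_iff complex_eq_iff)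
next
  case False
  have d: "Im (K x x) = 0" for x
    using finite_form_nonneg[of "{x}" "\<lambda>_. 1"] by (simp add: complex_nonneg_Reals_iff)
  have "Im (K x y) + Im (K y x) = 0"
    using finite_form_nonneg[of "{x, y}" "\<lambda>_. 1"] d[of x] d[of y] False
    by (simp add: complex_nonneg_Reals_iff)
  moreover have "Re (K x y) - Re (K y x) = 0"
    using finite_form_nonneg[of "{x, y}" "\<lambda>z. if z = x then 1 else \<i>"] d[of x] d[of y] False
    by (simp add: complex_nonneg_Reals_iff)
  ultimately show ?thesis by (simp add: complex_eq_iff)
qed

lemma semi_inner_space_kernel_combs: "semi_inner_space (kernel_combs K)"
proof
  fix f g h :: "'s \<Rightarrow> complex" and a b :: complex
  show "f + g \<in> vecs (kernel_combs K)" if "f \<in> vecs (kernel_combs K)" "g \<in> vecs (kernel_combs K)"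
    using that by (auto intro: finite_subset[of _ "{x. f x \<noteq> 0} \<union> {x. g x \<noteq> 0}"])
  show "scal (kernel_combs K) a f \<in> vecs (kernel_combs K)" if "f \<in> vecs (kernel_combs K)"
    using that by (auto intro: finite_subset[of _ "{x. f x \<noteq> 0}"])
  show "cip (kernel_combs K) f (g + h) = cip (kernel_combs K) f g + cip (kernel_combs K) f h"
    if "f \<in> vecs (kernel_combs K)" "g \<in> vecs (kernel_combs K)" "h \<in> vecs (kernel_combs K)"
  proof -
    let ?B = "{x. g x \<noteq> 0} \<union> {x. h x \<noteq> 0}"
    have "kernel_form K f u = (\<Sum>x | f x \<noteq> 0. \<Sum>y\<in>?B. cnj (f x) * u y * K x y)"
      if "{x. u x \<noteq> 0} \<subseteq> ?B" for u
      using that \<open>f \<in> _\<close> \<open>g \<in> _\<close> \<open>h \<in> _\<close> by (intro kernel_form_superset) auto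
    moreover have "{x. (g + h) x \<noteq> 0} \<subseteq> ?B" by auto
    ultimately show ?thesis by (simp add: sum.distrib[symmetric] algebra_simps)
  qed
  show "cip (kernel_combs K) f (scal (kernel_combs K) a g) = a * cip (kernel_combs K) f g"
    if "f \<in> vecs (kernel_combs K)" "g \<in> vecs (kernel_combs K)"
  proof -
    have "kernel_form K f u = (\<Sum>x | f x \<noteq> 0. \<Sum>y | g y \<noteq> 0. cnj (f x) * u y * K x y)"
      if "{x. u x \<noteq> 0} \<subseteq> {x. g x \<noteq> 0}" for u
      using that \<open>f \<in> _\<close> \<open>g \<in> _\<close> by (intro kernel_form_superset) auto
    from this[of g] this[of "\<lambda>x. a * g x"] show ?thesis
      by (auto simp: sum_distrib_left algebra_simps intro!: sum.cong)
  qed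
  show "cnj (cip (kernel_combs K) f g) = cip (kernel_combs K) g f"
    unfolding kernel_combs_simps kernel_form_def
    by (subst sum.swap) (simp add: hermitian[symmetric] mult_ac)
  show "0 \<le> Re (cip (kernel_combs K) f f)" if "f \<in> vecs (kernel_combs K)"
    using finite_form_nonneg[of "{x. f x \<noteq> 0}" f] that
    by (simp add: kernel_form_def complex_nonneg_Reals_iff)
qed (auto simp: algebra_simps)

sublocale combs: semi_inner_space "kernel_combs K"
  by (rule semi_inner_space_kernel_combs)

text \<open>
  The coefficients of the kernel section at \<open>y\<close>.
\<close>

definition point :: "'s \<Rightarrow> 's \<Rightarrow> complex" where
  "point y = (\<lambda>x. if x = y then 1 else 0)"

lemma point_vecs: "point y \<in> vecs (kernel_combs K)"
  by (simp add: point_def)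

lemma reproducing: "kernel_form K (point y) c = kernel_comb K c y"
proof -
  have "{x. point y x \<noteq> 0} = {y}" by (auto simp: point_def)
  then show ?thesis unfolding kernel_form_comb by (simp add: point_def)
qed

lemma kernel_comb_add:
  "c \<in> vecs (kernel_combs K) \<Longrightarrow> d \<in> vecs (kernel_combs K) \<Longrightarrow>
    kernel_comb K (c + d) y = kernel_comb K c y + kernel_comb K d y"
  using combs.cip_add_right[OF point_vecs] by (simp add: reproducing)

lemma kernel_comb_scal:
  "c \<in> vecs (kernel_combs K) \<Longrightarrow> kernel_comb K (\<lambda>x. a * c x) y = a * kernel_comb K c y"
  using combs.cip_scal_right[OF point_vecs] by (simp add: reproducing)

lemma kernel_comb_diff:
  "c \<in> vecs (kernel_combs K) \<Longrightarrow> d \<in> vecs (kernel_combs K) \<Longrightarrow>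
    kernel_comb K (c - d) y = kernel_comb K c y - kernel_comb K d y"
  using combs.cip_diff_right[OF point_vecs] by (simp add: reproducing)

lemma represents_iff:
  "represents K c f \<longleftrightarrow> combs.cauchy_seq c \<and> (\<forall>y. (\<lambda>n. kernel_comb K (c n) y) \<longlonglongrightarrow> f y)"
  unfolding represents_def combs.cauchy_seq_def by (auto simp: ips_norm_def)

lemma represents_add:
  assumes "represents K c f" "represents K d g"
  shows "represents K (\<lambda>n. c n + d n) (f + g)"
  using assms combs.cauchy_seq_vecs unfolding represents_iff
  by (auto intro!: combs.cauchy_seq_add tendsto_add simp: kernel_comb_add simp del: kernel_combs_simps)

lemma represents_scal:
  assumes "represents K c f"
  shows "represents K (\<lambda>n x. a * c n x) (\<lambda>y. a * f y)"
  using assms combs.cauchy_seq_vecs combs.cauchy_seq_scal[of c a] unfolding represents_iff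
  by (auto intro!: tendsto_mult_left simp: kernel_comb_scal simp del: kernel_combs_simps(1,3))

lemma represents_diff:
  assumes "represents K c f" "represents K d g"
  shows "represents K (\<lambda>n. c n - d n) (f - g)"
  using assms combs.cauchy_seq_vecs unfolding represents_iff
  by (auto intro!: combs.cauchy_seq_diff tendsto_diff simp: kernel_comb_diff simp del: kernel_combs_simps)

lemma represents_kernel_comb:
  "c \<in> vecs (kernel_combs K) \<Longrightarrow> represents K (\<lambda>_. c) (kernel_comb K c)"
  unfolding represents_iff by (simp add: combs.cauchy_seq_const)

text \<open>
  Pointwise convergence to \<open>0\<close> is weak convergence against the span of the kernel sections, hence strong
  convergence for Cauchy sequences.
\<close>

lemma represents_zero_null:
  assumes c: "represents K c 0"
  shows "(\<lambda>n. combs.nrm (c n)) \<longlonglongrightarrow> 0"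
proof (rule combs.cauchy_seq_weakly_null)
  show "combs.cauchy_seq c" using c by (simp add: represents_iff)
  fix g assume "g \<in> vecs (kernel_combs K)"
  have "(\<lambda>n. \<Sum>x | g x \<noteq> 0. cnj (g x) * kernel_comb K (c n) x)
      \<longlonglongrightarrow> (\<Sum>x | g x \<noteq> 0. cnj (g x) * (0 :: 's \<Rightarrow> complex) x)"
    using c by (intro tendsto_sum tendsto_mult_left) (auto simp: represents_iff)
  then show "(\<lambda>n. cip (kernel_combs K) g (c n)) \<longlonglongrightarrow> 0"
    by (simp add: kernel_form_comb)
qed

text \<open>
  The limit exists by Cauchy--Schwarz; replacing both sequences by others with the same pointwise limits
  changes the form by two terms, each containing a null sequence. So the definite description in the
  inner product of \<open>rkhs\<close> denotes this limit, and every inner product axiom passes to the limit.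
\<close>

lemma cip_rkhs_limit:
  assumes f: "represents K c f" and g: "represents K d g"
  shows "(\<lambda>n. kernel_form K (c n) (d n)) \<longlonglongrightarrow> cip (rkhs K) f g"
proof -
  have cauchy: "combs.cauchy_seq c" "combs.cauchy_seq d" using f g by (auto simp: represents_iff)
  obtain z where z: "(\<lambda>n. kernel_form K (c n) (d n)) \<longlonglongrightarrow> z"
    using combs.cauchy_seq_cip_convergent[OF cauchy] by (auto simp: convergent_def)
  have any: "(\<lambda>n. kernel_form K (c' n) (d' n)) \<longlonglongrightarrow> z"
    if f': "represents K c' f" and g': "represents K d' g" for c' d'
  proof -
    have cauchy': "combs.cauchy_seq c'" "combs.cauchy_seq d'" using f' g' by (auto simp: represents_iff)
    note mem = cauchy[THEN combs.cauchy_seq_vecs] cauchy'[THEN combs.cauchy_seq_vecs]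
    have null: "(\<lambda>n. combs.nrm (c' n - c n)) \<longlonglongrightarrow> 0" "(\<lambda>n. combs.nrm (d' n - d n)) \<longlonglongrightarrow> 0"
      using represents_zero_null represents_diff[OF f' f] represents_diff[OF g' g] by auto
    have 1: "(\<lambda>n. kernel_form K (c' n - c n) (d' n)) \<longlonglongrightarrow> 0"
      using combs.cauchy_seq_cip_null[OF combs.cauchy_seq_diff[OF cauchy'(1) cauchy(1)] cauchy'(2) null(1)]
      by simp
    have 2: "(\<lambda>n. cnj (kernel_form K (d' n - d n) (c n))) \<longlonglongrightarrow> cnj 0"
      using combs.cauchy_seq_cip_null[OF combs.cauchy_seq_diff[OF cauchy'(2) cauchy(2)] cauchy(1) null(2)]
      by (intro tendsto_cnj) simp
    have eq: "kernel_form K (c' n) (d' n) = kernel_form K (c n) (d n) +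
        kernel_form K (c' n - c n) (d' n) + cnj (kernel_form K (d' n - d n) (c n))" for n
    proof -
      have "cip (kernel_combs K) (c' n) (d' n) = cip (kernel_combs K) (c n) (d n) +
        cip (kernel_combs K) (c' n - c n) (d' n) + cip (kernel_combs K) (c n) (d' n - d n)"
        using mem(1)[of n] mem(2)[of n] mem(3)[of n] mem(4)[of n]
        by (simp add: combs.cip_diff_left combs.cip_diff_right del: kernel_combs_simps)
      also have "cip (kernel_combs K) (c n) (d' n - d n) = cnj (cip (kernel_combs K) (d' n - d n) (c n))"
        using combs.cnj_cip[OF combs.diff_vecs[OF mem(4)[of n] mem(2)[of n]] mem(1)[of n]] by simp
      finally show ?thesis by (simp only: kernel_combs_simps)
    qed
    show ?thesis unfolding eq using tendsto_add[OF tendsto_add[OF z 1] 2] by simp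
  qed
  have "cip (rkhs K) f g = z"
    unfolding rkhs_def ips.simps
  proof (rule the_equality)
    show "\<forall>c d. represents K c f \<longrightarrow> represents K d g \<longrightarrow> (\<lambda>n. kernel_form K (c n) (d n)) \<longlonglongrightarrow> z"
      using any by blast
    fix w assume "\<forall>c d. represents K c f \<longrightarrow> represents K d g \<longrightarrow> (\<lambda>n. kernel_form K (c n) (d n)) \<longlonglongrightarrow> w"
    then have "(\<lambda>n. kernel_form K (c n) (d n)) \<longlonglongrightarrow> w" using f g by blast
    then show "w = z" using z LIMSEQ_unique by blast
  qed
  then show ?thesis using z by simp
qed

lemma nrm_rkhs_limit:
  assumes "represents K c f"
  shows "(\<lambda>n. combs.nrm (c n)) \<longlonglongrightarrow> ips_norm (rkhs K) f"
  unfolding ips_norm_def using cip_rkhs_limit[OF assms assms]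
  by (simp add: tendsto_real_sqrt tendsto_Re)

lemma inner_space_rkhs: "inner_space (rkhs K)"
proof
  fix f g h :: "'s \<Rightarrow> complex" and a b :: complex
  show "(0 :: 's \<Rightarrow> complex) \<in> vecs (rkhs K)"
    unfolding rkhs_simps represents_iff
    by (rule exI[of _ "\<lambda>_. 0"]) (auto simp: kernel_comb_def combs.cauchy_seq_const)
  show "f + g \<in> vecs (rkhs K)" if "f \<in> vecs (rkhs K)" "g \<in> vecs (rkhs K)"
    using that represents_add unfolding rkhs_simps by blast
  show "scal (rkhs K) a f \<in> vecs (rkhs K)" if "f \<in> vecs (rkhs K)"
    using that represents_scal unfolding rkhs_simps by blast
  show "cip (rkhs K) f (g + h) = cip (rkhs K) f g + cip (rkhs K) f h"
    if mem: "f \<in> vecs (rkhs K)" "g \<in> vecs (rkhs K)" "h \<in> vecs (rkhs K)"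
  proof -
    obtain c d e where r: "represents K c f" "represents K d g" "represents K e h"
      using mem unfolding rkhs_simps by blast
    have "kernel_form K (c n) (d n + e n) = kernel_form K (c n) (d n) + kernel_form K (c n) (e n)" for n
      using combs.cip_add_right[of "c n" "d n" "e n"] r combs.cauchy_seq_vecs
      unfolding represents_iff kernel_combs_simps(3) by blast
    then have "(\<lambda>n. kernel_form K (c n) (d n) + kernel_form K (c n) (e n)) \<longlonglongrightarrow> cip (rkhs K) f (g + h)"
      using cip_rkhs_limit[OF r(1) represents_add[OF r(2,3)]] by simp
    then show ?thesis
      using tendsto_add[OF cip_rkhs_limit[OF r(1,2)] cip_rkhs_limit[OF r(1,3)]] LIMSEQ_unique by blast
  qed
  show "cip (rkhs K) f (scal (rkhs K) a g) = a * cip (rkhs K) f g"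
    if mem: "f \<in> vecs (rkhs K)" "g \<in> vecs (rkhs K)"
  proof -
    obtain c d where r: "represents K c f" "represents K d g"
      using mem unfolding rkhs_simps by blast
    have "kernel_form K (c n) (\<lambda>x. a * d n x) = a * kernel_form K (c n) (d n)" for n
      using combs.cip_scal_right[of "c n" "d n" a] r combs.cauchy_seq_vecs
      unfolding represents_iff kernel_combs_simps(2,3) by blast
    then have "(\<lambda>n. a * kernel_form K (c n) (d n)) \<longlonglongrightarrow> cip (rkhs K) f (scal (rkhs K) a g)"
      using cip_rkhs_limit[OF r(1) represents_scal[OF r(2), of a]] by (simp add: rkhs_simps)
    then show ?thesis using tendsto_mult_left[OF cip_rkhs_limit[OF r]] LIMSEQ_unique by blast
  qed
  show "cnj (cip (rkhs K) f g) = cip (rkhs K) g f"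
    if mem: "f \<in> vecs (rkhs K)" "g \<in> vecs (rkhs K)"
  proof -
    obtain c d where r: "represents K c f" "represents K d g"
      using mem unfolding rkhs_simps by blast
    have "cnj (kernel_form K (c n) (d n)) = kernel_form K (d n) (c n)" for n
      using combs.cnj_cip[of "c n" "d n"] r combs.cauchy_seq_vecs
      unfolding represents_iff kernel_combs_simps(3) by blast
    then show ?thesis
      using tendsto_cnj[OF cip_rkhs_limit[OF r]] cip_rkhs_limit[OF r(2,1)] LIMSEQ_unique by fastforce
  qed
  show "0 \<le> Re (cip (rkhs K) f f)" if mem: "f \<in> vecs (rkhs K)"
  proof -
    obtain c where r: "represents K c f" using mem unfolding rkhs_simps by blast
    have "0 \<le> Re (kernel_form K (c n) (c n))" for n
      using combs.Re_cip_nonneg[of "c n"] r combs.cauchy_seq_vecs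
      unfolding represents_iff kernel_combs_simps(3) by blast
    then show ?thesis
      by (intro LIMSEQ_le_const[OF tendsto_Re[OF cip_rkhs_limit[OF r r]]]) auto
  qed
  show "f = 0" if mem: "f \<in> vecs (rkhs K)" and 0: "cip (rkhs K) f f = 0"
  proof
    fix y
    obtain c where r: "represents K c f" using mem unfolding rkhs_simps by blast
    have c: "combs.cauchy_seq c" using r by (simp add: represents_iff)
    have "(\<lambda>n. combs.nrm (c n)) \<longlonglongrightarrow> 0"
      using nrm_rkhs_limit[OF r] 0 by (simp add: ips_norm_def)
    then have "(\<lambda>n. cip (kernel_combs K) (c n) (point y)) \<longlonglongrightarrow> 0"
      by (rule combs.cauchy_seq_cip_null[OF c combs.cauchy_seq_const[OF point_vecs]])
    then have "(\<lambda>n. cnj (cip (kernel_combs K) (c n) (point y))) \<longlonglongrightarrow> 0"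
      using tendsto_cnj by fastforce
    then have "(\<lambda>n. kernel_comb K (c n) y) \<longlonglongrightarrow> 0"
      using combs.cnj_cip[OF combs.cauchy_seq_vecs[OF c] point_vecs] by (simp add: reproducing)
    moreover have "(\<lambda>n. kernel_comb K (c n) y) \<longlonglongrightarrow> f y" using r by (simp add: represents_iff)
    ultimately show "f y = 0 y" using LIMSEQ_unique by fastforce
  qed
qed (auto simp: rkhs_simps algebra_simps)

sublocale rkhs: inner_space "rkhs K"
  by (rule inner_space_rkhs)

lemma kernel_comb_vecs: "c \<in> vecs (kernel_combs K) \<Longrightarrow> kernel_comb K c \<in> vecs (rkhs K)"
  using represents_kernel_comb unfolding rkhs_simps by blast

lemma nrm_kernel_comb_diff:
  assumes "c \<in> vecs (kernel_combs K)" "d \<in> vecs (kernel_combs K)"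
  shows "rkhs.nrm (kernel_comb K c - kernel_comb K d) = combs.nrm (c - d)"
  using nrm_rkhs_limit[OF represents_diff[OF represents_kernel_comb represents_kernel_comb], OF assms]
  by (simp add: LIMSEQ_const_iff)

text \<open>
  The span of the kernel sections is dense, and a representing sequence converges in norm.
\<close>

lemma represents_tendsto:
  assumes r: "represents K c f"
  shows "(\<lambda>n. rkhs.nrm (f - kernel_comb K (c n))) \<longlonglongrightarrow> 0"
proof (rule LIMSEQ_I)
  fix e :: real assume "e > 0"
  then have e: "e / 2 > 0" by simp
  have c: "combs.cauchy_seq c" using r by (simp add: represents_iff)
  note mem = combs.cauchy_seq_vecs[OF c]
  obtain M where M: "\<And>m n. m \<ge> M \<Longrightarrow> n \<ge> M \<Longrightarrow> combs.nrm (c m - c n) < e / 2"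
    using combs.cauchy_seqD[OF c e] by metis
  have "norm (rkhs.nrm (f - kernel_comb K (c n)) - 0) < e" if "n \<ge> M" for n
  proof -
    have "f \<in> vecs (rkhs K)" using r unfolding rkhs_simps by blast
    then have "0 \<le> rkhs.nrm (f - kernel_comb K (c n))"
      by (intro rkhs.nrm_nonneg rkhs.diff_vecs kernel_comb_vecs mem)
    moreover have "rkhs.nrm (f - kernel_comb K (c n)) \<le> e / 2"
    proof (rule LIMSEQ_le_const2)
      show "(\<lambda>m. combs.nrm (c m - c n)) \<longlonglongrightarrow> rkhs.nrm (f - kernel_comb K (c n))"
        using r mem by (intro nrm_rkhs_limit represents_diff represents_kernel_comb)
      show "\<exists>N. \<forall>m\<ge>N. combs.nrm (c m - c n) \<le> e / 2"
        using M that less_imp_le by blast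
    qed
    ultimately show ?thesis using \<open>e > 0\<close> by simp
  qed
  then show "\<exists>M. \<forall>n\<ge>M. norm (rkhs.nrm (f - kernel_comb K (c n)) - 0) < e" by blast
qed

text \<open>
  A Cauchy sequence in \<open>rkhs\<close> is shadowed at distance \<open>1/(n+1)\<close> by combinations of kernel sections. The
  shadow is again Cauchy, its pointwise limit exists because point evaluations are continuous, and
  this limit is the limit of the given sequence in norm.
\<close>

lemma hilbert_space_rkhs: "hilbert_space (rkhs K)"
proof
  fix X assume X: "rkhs.cauchy_seq X"
  note memX = rkhs.cauchy_seq_vecs[OF X]
  define \<eta> where "\<eta> n = 1 / real (Suc n)" for n
  have \<eta>0: "\<eta> \<longlonglongrightarrow> 0"
    unfolding \<eta>_def using LIMSEQ_inverse_real_of_nat by (simp add: inverse_eq_divide)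
  have "\<exists>d\<in>vecs (kernel_combs K). rkhs.nrm (X n - kernel_comb K d) < \<eta> n" for n
  proof -
    obtain c where r: "represents K c (X n)" using memX[of n] unfolding rkhs_simps by blast
    have "\<eta> n > 0" by (simp add: \<eta>_def)
    then obtain m where "rkhs.nrm (X n - kernel_comb K (c m)) < \<eta> n"
      using order_tendstoD(2)[OF represents_tendsto[OF r]] eventually_happens' sequentially_bot by blast
    then show ?thesis using r combs.cauchy_seq_vecs unfolding represents_iff by blast
  qed
  then obtain d where d: "\<And>n. d n \<in> vecs (kernel_combs K)"
    and dX: "\<And>n. rkhs.nrm (X n - kernel_comb K (d n)) < \<eta> n" by metis
  note memd = kernel_comb_vecs[OF d]
  have cauchy: "combs.cauchy_seq d"
    unfolding combs.cauchy_seq_def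
  proof (intro conjI allI impI d)
    fix \<epsilon> :: real assume "\<epsilon> > 0"
    then have e: "\<epsilon> / 3 > 0" by simp
    obtain M where M: "\<And>m n. m \<ge> M \<Longrightarrow> n \<ge> M \<Longrightarrow> rkhs.nrm (X m - X n) < \<epsilon> / 3"
      using rkhs.cauchy_seqD[OF X e] by metis
    obtain N where N: "\<And>n. n \<ge> N \<Longrightarrow> \<eta> n < \<epsilon> / 3"
      using order_tendstoD(2)[OF \<eta>0 e] unfolding eventually_sequentially by blast
    have "combs.nrm (d m - d n) < \<epsilon>" if mn: "m \<ge> max M N" "n \<ge> max M N" for m n
    proof -
      have "combs.nrm (d m - d n) = rkhs.nrm (kernel_comb K (d m) - kernel_comb K (d n))"
        by (simp only: nrm_kernel_comb_diff[OF d d])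
      also have "\<dots> \<le> rkhs.nrm (kernel_comb K (d m) - X m) + rkhs.nrm (X m - kernel_comb K (d n))"
        using memX memd by (intro rkhs.nrm_triangle_diff)
      also have "rkhs.nrm (X m - kernel_comb K (d n))
          \<le> rkhs.nrm (X m - X n) + rkhs.nrm (X n - kernel_comb K (d n))"
        using memX memd by (intro rkhs.nrm_triangle_diff)
      also have "rkhs.nrm (kernel_comb K (d m) - X m) = rkhs.nrm (X m - kernel_comb K (d m))"
        using memX memd by (intro rkhs.nrm_minus_commute)
      finally show ?thesis using M[of m n] dX[of m] dX[of n] N[of m] N[of n] mn by linarith
    qed
    then show "\<exists>M. \<forall>m\<ge>M. \<forall>n\<ge>M. combs.nrm (d m - d n) < \<epsilon>" by blast
  qed
  have "convergent (\<lambda>n. kernel_comb K (d n) y)" for y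
    using combs.cauchy_seq_cip_convergent[OF combs.cauchy_seq_const[OF point_vecs] cauchy]
    by (simp add: reproducing)
  then obtain f where f: "\<And>y. (\<lambda>n. kernel_comb K (d n) y) \<longlonglongrightarrow> f y"
    unfolding convergent_def by metis
  have r: "represents K d f" using cauchy f by (simp add: represents_iff)
  then have memf: "f \<in> vecs (rkhs K)" unfolding rkhs_simps by blast
  have "(\<lambda>n. rkhs.nrm (X n - f)) \<longlonglongrightarrow> 0"
  proof (rule Lim_null_comparison)
    have "norm (rkhs.nrm (X n - f)) \<le> \<eta> n + rkhs.nrm (f - kernel_comb K (d n))" for n
    proof -
      have "rkhs.nrm (X n - f) \<le> rkhs.nrm (X n - kernel_comb K (d n)) + rkhs.nrm (kernel_comb K (d n) - f)"
        using memX memd memf by (intro rkhs.nrm_triangle_diff)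
      moreover have "rkhs.nrm (kernel_comb K (d n) - f) = rkhs.nrm (f - kernel_comb K (d n))"
        using memd memf by (intro rkhs.nrm_minus_commute)
      moreover have "0 \<le> rkhs.nrm (X n - f)" using memX memf by simp
      ultimately show ?thesis using dX[of n] by simp
    qed
    then show "\<forall>\<^sub>F n in sequentially. norm (rkhs.nrm (X n - f)) \<le> \<eta> n + rkhs.nrm (f - kernel_comb K (d n))"
      by simp
    show "(\<lambda>n. \<eta> n + rkhs.nrm (f - kernel_comb K (d n))) \<longlonglongrightarrow> 0"
      using tendsto_add[OF \<eta>0 represents_tendsto[OF r]] by simp
  qed
  then show "\<exists>l\<in>vecs (rkhs K). (\<lambda>n. rkhs.nrm (X n - l)) \<longlonglongrightarrow> 0" using memf by blast
qed

end

section \<open>Hilbert--Schmidt norms, unit projections and operators of rank one\<close>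

abbreviation chosen_basis :: "'v::ab_group_add ips \<Rightarrow> 'v set" where
  "chosen_basis H \<equiv> (SOME B. orthonormal_basis H B)"

context inner_space
begin

lemma chosen_basis: "\<exists>B. orthonormal_basis H B \<Longrightarrow> orthonormal_basis H (chosen_basis H)"
  by (rule someI_ex)

lemma orthonormal_basis_vecs: "orthonormal_basis H B \<Longrightarrow> e \<in> B \<Longrightarrow> e \<in> vecs H"
  unfolding orthonormal_basis_def by blast

lemma cip_ext_right:
  assumes "f \<in> vecs H" "g \<in> vecs H" "\<And>h. h \<in> vecs H \<Longrightarrow> cip H h f = cip H h g"
  shows "f = g"
proof (rule cip_ext[OF assms(1,2)])
  fix h assume h: "h \<in> vecs H"
  have "cnj (cip H h f) = cnj (cip H h g)" using assms(3)[OF h] by simp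
  then show "cip H f h = cip H g h"
    unfolding cnj_cip[OF h assms(1)] cnj_cip[OF h assms(2)] .
qed

lemma nrm_sq_scal_remainder:
  assumes "f \<in> vecs H" "p \<in> vecs H" "nrm p = 1"
  shows "(nrm (f - scal H (cip H p f) p))\<^sup>2 = (nrm f)\<^sup>2 - (cmod (cip H p f))\<^sup>2"
proof -
  have "scal H (of_real 1 * cip H p f) p = scal H (cip H p f) p" by simp
  with nrm_sq_diff_scal[OF assms(1,2), of 1] assms(3) show ?thesis by simp
qed

text \<open>
  With an explicit adjoint at hand the trace of \<open>A\<^sup>* A\<close> is the sum of the squared norms of the \<open>A e\<close>. Both
  sides are \<open>0\<close> when the sum diverges, so the formula also yields summability from a nonzero
  Hilbert--Schmidt norm.
\<close>

lemma hs_norm_infsum: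
  assumes ex: "\<exists>B. orthonormal_basis H B" and H2: "semi_inner_space H2"
    and A: "\<And>f. f \<in> vecs H \<Longrightarrow> A f \<in> vecs H2" and A': "\<And>g. g \<in> vecs H2 \<Longrightarrow> A' g \<in> vecs H"
    and adj: "\<And>f g. f \<in> vecs H \<Longrightarrow> g \<in> vecs H2 \<Longrightarrow> cip H (A' g) f = cip H2 g (A f)"
  shows "hs_norm H H2 A = sqrt (Re (\<Sum>\<^sub>\<infinity>e\<in>chosen_basis H. cip H2 (A e) (A e)))"
proof -
  have "cip H e (adj H H2 A (A e)) = cip H2 (A e) (A e)" if "e \<in> chosen_basis H" for e
  proof -
    have e: "e \<in> vecs H" using chosen_basis[OF ex] that by (rule orthonormal_basis_vecs)
    have "adj H H2 A (A e) = A' (A e)" using A[OF e] A' adj by (intro adj_eqI) auto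
    moreover have "cip H e (A' (A e)) = cnj (cip H2 (A e) (A e))"
      using cnj_cip[OF A'[OF A[OF e]] e] adj[OF e A[OF e]] by simp
    ultimately show ?thesis using semi_inner_space.cnj_cip[OF H2 A[OF e] A[OF e]] by simp
  qed
  then show ?thesis unfolding hs_norm_def op_trace_def by (simp cong: infsum_cong)
qed

lemma hs_norm_eqI:
  assumes "\<exists>B. orthonormal_basis H B" "semi_inner_space H2"
    "\<And>f. f \<in> vecs H \<Longrightarrow> A f \<in> vecs H2" "\<And>g. g \<in> vecs H2 \<Longrightarrow> A' g \<in> vecs H"
    "\<And>f g. f \<in> vecs H \<Longrightarrow> g \<in> vecs H2 \<Longrightarrow> cip H (A' g) f = cip H2 g (A f)"
    and sum: "\<And>B. orthonormal_basis H B \<Longrightarrow> ((\<lambda>e. cip H2 (A e) (A e)) has_sum s) B"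
  shows "hs_norm H H2 A = sqrt (Re s)"
  using hs_norm_infsum[OF assms(1-5)] infsumI[OF sum[OF chosen_basis[OF assms(1)]]] by simp

lemma op_trace_eqI:
  assumes "\<exists>B. orthonormal_basis H B"
    and sum: "\<And>B. orthonormal_basis H B \<Longrightarrow> ((\<lambda>e. cip H e (T e)) has_sum s) B"
  shows "op_trace H T = s"
  unfolding op_trace_def by (rule infsumI[OF sum[OF chosen_basis[OF assms(1)]]])

text \<open>
  Equality in Cauchy--Schwarz: unit vectors with \<open>|\<langle>p, q\<rangle>| \<ge> 1\<close> differ by a phase, which cancels in the
  projection.
\<close>

lemma ketbra_unit_phase:
  assumes p: "p \<in> vecs H" "nrm p = 1" and q: "q \<in> vecs H" "nrm q = 1"
    and ge: "1 \<le> (cmod (cip H p q))\<^sup>2" and f: "f \<in> vecs H"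
  shows "ketbra H q q f = ketbra H p p f"
proof -
  let ?c = "cip H p q"
  have "(nrm (q - scal H ?c p))\<^sup>2 = 1 - (cmod ?c)\<^sup>2"
    using nrm_sq_scal_remainder[OF q(1) p] q by simp
  then have *: "(nrm (q - scal H ?c p))\<^sup>2 = 0" "(cmod ?c)\<^sup>2 = 1"
    using ge zero_le_power2[of "nrm (q - scal H ?c p)"] by linarith+
  then have eq: "q = scal H ?c p" using nrm_eq_0_iff[of "q - scal H ?c p"] p q by simp
  have "ketbra H q q f = ketbra H (scal H ?c p) (scal H ?c p) f" by (simp only: eq[symmetric])
  also have "\<dots> = scal H ((cnj ?c * ?c) * cip H p f) p"
    unfolding ketbra_def using p f by (simp add: cip_scal_left mult_ac)
  finally show ?thesis using * by (simp add: ketbra_def mult_cnj_norm)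
qed

end

context hilbert_space
begin

lemma ketbra_selfadjoint_projection:
  assumes q: "q \<in> vecs H" "nrm q = 1"
  shows "selfadjoint_projection H (ketbra H q q)"
proof -
  have b: "bounded_op H H (ketbra H q q)"
    unfolding bounded_op_def ketbra_def
  proof (intro conjI ballI allI exI[of _ 1])
    fix f assume f: "f \<in> vecs H"
    show "nrm (scal H (cip H q f) q) \<le> 1 * nrm f"
      using Cauchy_Schwarz[OF q(1) f] q by (simp add: nrm_scal)
  qed (use q in \<open>auto simp: cip_add_right cip_scal_right scal_add_left\<close>)
  have a: "adj H H (ketbra H q q) f = ketbra H q q f" if "f \<in> vecs H" for f
    using q that by (intro adj_eqI) (simp_all add: ketbra_def cip_scal_left cip_scal_right cnj_cip)
  have i: "ketbra H q q (ketbra H q q f) = ketbra H q q f" if "f \<in> vecs H" for f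
    using q that cip_self[OF q(1)] by (simp add: ketbra_def cip_scal_right)
  show ?thesis unfolding selfadjoint_projection_def op_eq_def using a b i by simp
qed

lemma ketbra_unit_hs_norm:
  assumes q: "q \<in> vecs H" "nrm q = 1"
  shows "hs_norm H H (ketbra H q q) = 1"
proof -
  have "hs_norm H H (ketbra H q q) = sqrt (Re (cip H q q))"
  proof (rule hs_norm_eqI[where A' = "ketbra H q q"])
    fix B assume B: "orthonormal_basis H B"
    have "cip H (ketbra H q q e) (ketbra H q q e) = cip H q e * cip H e q" if "e \<in> B" for e
    proof -
      have e: "e \<in> vecs H" using B that by (rule orthonormal_basis_vecs)
      show ?thesis using e q cip_self[OF q(1)]
        by (simp add: ketbra_def cip_scal_left cip_scal_right cnj_cip)
    qed
    then show "((\<lambda>e. cip H (ketbra H q q e) (ketbra H q q e)) has_sum cip H q q) B"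
      using parseval[OF B q(1) q(1)] by (subst has_sum_cong) auto
  qed (use q in \<open>auto simp: ketbra_def cip_scal_left cip_scal_right cnj_cip
      intro: orthonormal_basis_exists semi_inner_space_axioms\<close>)
  then show ?thesis using cip_self[OF q(1)] q by simp
qed

text \<open>
  A selfadjoint projection of Hilbert--Schmidt norm one has rank one. Pick a unit vector \<open>q\<close> in its range.
  Then \<open>|\<langle>q, e\<rangle>| = |\<langle>q, Q e\<rangle>| \<le> |Q e|\<close> for every basis vector \<open>e\<close>, while both families of squares sum to one.
  So equality holds for every \<open>e\<close>, which means \<open>Q e = \<langle>q, e\<rangle> q\<close>.
\<close>

lemma projection_of_unit_hs_norm:
  assumes Q: "selfadjoint_projection H Q" and hs: "(hs_norm H H Q)\<^sup>2 = 1"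
  obtains q where "q \<in> vecs H" "nrm q = 1" "\<And>f. f \<in> vecs H \<Longrightarrow> Q f = ketbra H q q f"
proof -
  have bd: "bounded_op H H Q" and adj: "\<And>f. f \<in> vecs H \<Longrightarrow> adj H H Q f = Q f"
    and idem: "\<And>f. f \<in> vecs H \<Longrightarrow> Q (Q f) = Q f"
    using Q unfolding selfadjoint_projection_def op_eq_def comp_apply by (blast, blast intro: sym, blast intro: sym)
  have QH: "\<And>f. f \<in> vecs H \<Longrightarrow> Q f \<in> vecs H" using bd unfolding bounded_op_def by blast
  have Qscal: "\<And>a f. f \<in> vecs H \<Longrightarrow> Q (scal H a f) = scal H a (Q f)"
    using bd unfolding bounded_op_def by blast
  have sym: "cip H (Q g) f = cip H g (Q f)" if "f \<in> vecs H" "g \<in> vecs H" for f g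
    using adj_bounded_op(2)[OF bd that(2,1)] adj that by simp
  define B where "B = chosen_basis H"
  have B: "orthonormal_basis H B"
    unfolding B_def by (rule chosen_basis[OF orthonormal_basis_exists])
  note BH = orthonormal_basis_vecs[OF B]
  define S where "S = (\<Sum>\<^sub>\<infinity>e\<in>B. cip H (Q e) (Q e))"
  have "hs_norm H H Q = sqrt (Re S)" unfolding S_def B_def
    by (rule hs_norm_infsum[where A' = Q])
      (use QH sym in \<open>auto intro: orthonormal_basis_exists semi_inner_space_axioms\<close>)
  then have abs1: "\<bar>Re S\<bar> = 1" using hs by (simp add: power2_eq_square)
  \<comment> \<open>A divergent sum has the value zero, so a nonzero value gives convergence.\<close>
  then have "S \<noteq> 0" by auto
  then have "((\<lambda>e. cip H (Q e) (Q e)) has_sum S) B"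
    unfolding S_def using infsum_not_exists has_sum_infsum by blast
  then have "((\<lambda>e. Re (cip H (Q e) (Q e))) has_sum Re S) B" by (rule has_sum_Re)
  then have sumS: "((\<lambda>e. (nrm (Q e))\<^sup>2) has_sum Re S) B"
    using BH QH by (subst has_sum_cong[where g = "\<lambda>e. Re (cip H (Q e) (Q e))"]) (auto simp: nrm_sq)
  have "0 \<le> Re S" using sumS by (rule has_sum_nonneg) simp
  then have S1: "Re S = 1" using abs1 by simp
  have "\<exists>e\<in>B. Q e \<noteq> 0"
  proof (rule ccontr)
    assume "\<not> ?thesis"
    then have "((\<lambda>e. (nrm (Q e))\<^sup>2) has_sum 0) B" by (intro has_sum_0) auto
    then show False using sumS S1 has_sum_unique by fastforce
  qed
  then obtain b where b: "b \<in> vecs H" "Q b \<noteq> 0" using BH by blast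
  have n0: "nrm (Q b) \<noteq> 0" using b QH nrm_eq_0_iff by blast
  define q where "q = scal H (of_real (1 / nrm (Q b))) (Q b)"
  have q: "q \<in> vecs H" "nrm q = 1" "Q q = q"
    using b QH n0 by (simp_all add: q_def nrm_scal norm_divide Qscal idem)
  have qQ: "cip H q (Q f) = cip H q f" if "f \<in> vecs H" for f
    using sym[OF that q(1)] q by simp
  have "((\<lambda>e. Re (cip H q e * cip H e q)) has_sum Re (cip H q q)) B"
    by (intro has_sum_Re parseval B q)
  moreover have "Re (cip H q e * cip H e q) = (cmod (cip H q e))\<^sup>2" if "e \<in> B" for e
    using mult_cnj_norm(2)[of "cip H q e"] cnj_cip[OF q(1) BH[OF that]] by simp
  ultimately have sumq: "((\<lambda>e. (cmod (cip H q e))\<^sup>2) has_sum 1) B"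
    using cip_self[OF q(1)] q
    by (subst has_sum_cong[where g = "\<lambda>e. Re (cip H q e * cip H e q)"]) auto
  have rem: "(nrm (Q e - scal H (cip H q e) q))\<^sup>2 = (nrm (Q e))\<^sup>2 - (cmod (cip H q e))\<^sup>2" if "e \<in> vecs H" for e
    using nrm_sq_scal_remainder[OF QH[OF that] q(1,2)] qQ[OF that] by simp
  have "((\<lambda>e. (nrm (Q e))\<^sup>2 + - (cmod (cip H q e))\<^sup>2) has_sum (1 + - 1)) B"
    using sumS sumq S1 by (intro has_sum_add) (auto simp: has_sum_uminus)
  then have sum0: "((\<lambda>e. (nrm (Q e - scal H (cip H q e) q))\<^sup>2) has_sum 0) B"
    using rem BH by (subst has_sum_cong[where g = "\<lambda>e. (nrm (Q e))\<^sup>2 + - (cmod (cip H q e))\<^sup>2"]) auto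
  have Qe: "Q e = scal H (cip H q e) q" if "e \<in> B" for e
  proof -
    have "(nrm (Q e - scal H (cip H q e) q))\<^sup>2 = 0"
      using nonneg_has_sum_le_0D[OF sum0 _ _ that] by simp
    then show ?thesis using nrm_eq_0_iff[of "Q e - scal H (cip H q e) q"] BH[OF that] QH q by simp
  qed
  show ?thesis
  proof (rule that[OF q(1,2)])
    fix f assume f: "f \<in> vecs H"
    show "Q f = ketbra H q q f"
    proof (rule cip_ext_right)
      fix h assume h: "h \<in> vecs H"
      have "cip H (Q h) e * cip H e f = cip H h q * (cip H q e * cip H e f)" if "e \<in> B" for e
        using sym[OF BH[OF that] h] Qe[OF that] BH[OF that] q h by (simp add: cip_scal_right)
      then have "((\<lambda>e. cip H (Q h) e * cip H e f) has_sum cip H h q * cip H q f) B"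
        using has_sum_cmult_right[OF parseval[OF B q(1) f], of "cip H h q"]
        by (subst has_sum_cong) auto
      then have "cip H (Q h) f = cip H h q * cip H q f"
        using parseval[OF B QH[OF h] f] has_sum_unique by blast
      then show "cip H h (Q f) = cip H h (ketbra H q q f)"
        using sym[OF f h] h q by (simp add: ketbra_def cip_scal_right)
    qed (use f q QH in \<open>auto simp: ketbra_def\<close>)
  qed
qed

text \<open>
  Normal form of a bounded operator of rank at most one. The vector \<open>p\<close> supplies a unit vector for the zero
  operator, which is \<open>|p\<rangle>\<langle>0|\<close>.
\<close>

lemma rank_le_one_ketbra:
  assumes A: "bounded_op H H A" and r: "rank_le_one H H A" and p: "p \<in> vecs H" "nrm p = 1"
  obtains u v where "u \<in> vecs H" "nrm u = 1" "v \<in> vecs H" "\<And>f. f \<in> vecs H \<Longrightarrow> A f = ketbra H u v f"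
proof -
  obtain w where w: "w \<in> vecs H" and Aw: "\<And>f. f \<in> vecs H \<Longrightarrow> \<exists>a. A f = scal H a w"
    using r unfolding rank_le_one_def by blast
  show ?thesis
  proof (cases "w = 0")
    case True
    then have "A f = ketbra H p 0 f" if "f \<in> vecs H" for f
      using Aw[OF that] that p by (auto simp: ketbra_def)
    then show ?thesis using that[of p 0] p by simp
  next
    case False
    then have n0: "nrm w \<noteq> 0" using w nrm_eq_0_iff by blast
    define u where "u = scal H (of_real (1 / nrm w)) w"
    have u: "u \<in> vecs H" "nrm u = 1" using w n0 by (simp_all add: u_def nrm_scal norm_divide)
    have wu: "w = scal H (of_real (nrm w)) u" using w n0 by (simp add: u_def)
    have uu: "cip H u u = 1" using cip_self[OF u(1)] u by simp
    \<comment> \<open>The coefficient of A f along u is \<open>\<langle>u, A f\<rangle> = \<langle>A\<^sup>* u, f\<rangle>\<close>.\<close>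
    define v where "v = adj H H A u"
    note v = adj_bounded_op[OF A u(1), folded v_def]
    have "A f = ketbra H u v f" if f: "f \<in> vecs H" for f
    proof -
      obtain a where "A f = scal H a w" using Aw f by blast
      then have a: "A f = scal H (a * of_real (nrm w)) u" using wu u by (metis scal_scal)
      then have "cip H v f = a * of_real (nrm w)" using v(2)[OF f] u uu by (simp add: cip_scal_right)
      then show ?thesis using a by (simp add: ketbra_def)
    qed
    then show ?thesis using that[of u v] u v by simp
  qed
qed

end

section \<open>The coordinate space\<close>

lemma Cn_simps [simp]:
  "vecs Cn = UNIV" "scal Cn = (*s)" "cip Cn u v = (\<Sum>j\<in>UNIV. cnj (u $ j) * v $ j)"
  by (simp_all add: Cn_def)

interpretation Cn: inner_space "Cn :: (complex ^ 'n) ips"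
proof
  fix f g h :: "complex ^ 'n" and a b :: complex
  show "0 \<le> Re (cip Cn f f)" by (simp add: sum_nonneg mult_cnj_norm flip: power2_eq_square)
  show "f = 0" if "cip Cn f f = 0"
  proof -
    have "of_real (\<Sum>j\<in>UNIV. (cmod (f $ j))\<^sup>2) = (0::complex)"
      using that by (simp add: mult_cnj_norm)
    then have "(\<Sum>j\<in>UNIV. (cmod (f $ j))\<^sup>2) = 0" using of_real_eq_0_iff by blast
    then show ?thesis by (simp add: sum_nonneg_eq_0_iff vec_eq_iff)
  qed
qed (auto simp: vec_eq_iff algebra_simps sum.distrib sum_distrib_left)

lemma orthonormal_basis_Cn: "\<exists>B. orthonormal_basis (Cn :: (complex ^ 'n) ips) B"
proof (rule exI[of _ "range (\<lambda>j. axis j 1)"])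
  have inner: "cip Cn (axis i 1) u = u $ i" for i and u :: "complex ^ 'n"
    by (simp add: axis_def if_distrib[of cnj] if_distrib[of "\<lambda>z. z * _"] cong: if_cong)
  have expand: "f = (\<Sum>e\<in>range (\<lambda>j. axis j 1). cip Cn e f *s e)" for f :: "complex ^ 'n"
  proof -
    have "(\<Sum>e\<in>range (\<lambda>j. axis j 1). cip Cn e f *s e) = (\<Sum>j\<in>UNIV. (f $ j) *s axis j 1)"
      by (subst sum.reindex) (auto simp: inner inj_on_def axis_eq_axis simp del: Cn_simps)
    then show ?thesis by (simp add: basis_expansion)
  qed
  show "orthonormal_basis (Cn :: (complex ^ 'n) ips) (range (\<lambda>j. axis j 1))"
    unfolding orthonormal_basis_def
  proof (intro conjI ballI allI impI)
    fix e e' :: "complex ^ 'n" assume "e \<in> range (\<lambda>j. axis j 1)" "e' \<in> range (\<lambda>j. axis j 1)"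
    then show "cip Cn e e' = (if e = e' then 1 else 0)"
      by (auto simp: inner axis_eq_axis simp del: Cn_simps) (auto simp: axis_def)
  next
    fix f :: "complex ^ 'n" and \<epsilon> :: real assume "\<epsilon> > 0"
    show "\<exists>F a. finite F \<and> F \<subseteq> range (\<lambda>j. axis j 1) \<and> ips_norm Cn (f - (\<Sum>e\<in>F. scal Cn (a e) e)) < \<epsilon>"
      by (rule exI[of _ "range (\<lambda>j. axis j 1)"], rule exI[of _ "\<lambda>e. cip Cn e f"])
        (use expand[of f] \<open>\<epsilon> > 0\<close> in \<open>auto simp del: Cn_simps(3)\<close>)
  qed auto
qed

section \<open>The frame operator of a finite sample\<close>

lemma has_sum_finite_sum:
  fixes f :: "'i \<Rightarrow> 'e \<Rightarrow> 'b::topological_comm_monoid_add"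
  assumes "\<And>i. i \<in> I \<Longrightarrow> (f i has_sum s i) B"
  shows "((\<lambda>e. \<Sum>i\<in>I. f i e) has_sum (\<Sum>i\<in>I. s i)) B"
proof -
  have "((\<lambda>F. \<Sum>i\<in>I. sum (f i) F) \<longlongrightarrow> (\<Sum>i\<in>I. s i)) (finite_subsets_at_top B)"
    using assms unfolding has_sum_def by (rule tendsto_sum)
  moreover have "(\<Sum>i\<in>I. sum (f i) F) = (\<Sum>e\<in>F. \<Sum>i\<in>I. f i e)" for F
    by (rule sum.swap)
  ultimately show ?thesis unfolding has_sum_def by (simp only:)
qed

text \<open>
  The extremal problems concern finitely many vectors of an arbitrary Hilbert space.
\<close>

locale sampled_features = hilbert_space H for H :: "'v::ab_group_add ips" +
  fixes \<Phi> :: "'s \<Rightarrow> 'v" and x :: "'n::finite \<Rightarrow> 's"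
  assumes feature_vecs [simp]: "\<Phi> (x j) \<in> vecs H"
begin

abbreviation G :: "'v \<Rightarrow> 'v" where "G \<equiv> frame_op H \<Phi> x"
abbreviation PhiX :: "complex ^ 'n \<Rightarrow> 'v" where "PhiX \<equiv> synthesis_op H \<Phi> x"
abbreviation L :: "'v \<Rightarrow> complex ^ 'n" where "L \<equiv> analysis_op H \<Phi> x"

lemma analysis_op_nth: "L f $ j = cip H (\<Phi> (x j)) f"
proof -
  have "L f $ j = (\<Sum>i\<in>UNIV. if i = j then cip H (\<Phi> (x i)) f else 0)"
    unfolding analysis_op_def sum_component by (intro sum.cong) (auto simp: axis_def)
  then show ?thesis by simp
qed

lemma synthesis_op_vecs [simp]: "PhiX c \<in> vecs H"
  by (simp add: synthesis_op_def)

lemma cip_synthesis_op: "f \<in> vecs H \<Longrightarrow> cip H f (PhiX c) = cip Cn (L f) c"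
  by (simp add: synthesis_op_def cip_sum_right cip_scal_right analysis_op_nth cnj_cip mult.commute)

lemma adj_synthesis_op: "f \<in> vecs H \<Longrightarrow> adj Cn H PhiX f = L f"
  by (rule Cn.adj_eqI) (simp_all add: cip_synthesis_op del: Cn_simps(3))

lemma adj_analysis_op: "adj H Cn L c = PhiX c"
proof (rule adj_eqI)
  fix f assume f: "f \<in> vecs H"
  show "cip H (PhiX c) f = cip Cn c (L f)"
    using cnj_cip[OF f synthesis_op_vecs[of c]] Cn.cnj_cip[of "L f" c] cip_synthesis_op[OF f, of c] by simp
qed simp

lemma frame_op_eq: "G f = PhiX (L f)"
  by (simp add: frame_op_def adj_analysis_op)

lemma frame_op_sum: "G f = (\<Sum>j\<in>UNIV. ketbra H (\<Phi> (x j)) (\<Phi> (x j)) f)"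
  by (simp add: frame_op_eq synthesis_op_def analysis_op_nth ketbra_def)

lemma frame_op_vecs [simp]: "G f \<in> vecs H"
  by (simp add: frame_op_eq)

lemma cip_frame_op: "f \<in> vecs H \<Longrightarrow> cip H f (G g) = cip Cn (L f) (L g)"
  by (simp only: frame_op_eq cip_synthesis_op)

lemma frame_op_selfadjoint: "f \<in> vecs H \<Longrightarrow> g \<in> vecs H \<Longrightarrow> cip H (G f) g = cip H f (G g)"
  using cnj_cip[of g "G f"] Cn.cnj_cip[of "L g" "L f"] by (simp add: cip_frame_op del: Cn_simps(3))

lemma Re_cip_frame_op_nonneg: "f \<in> vecs H \<Longrightarrow> 0 \<le> Re (cip H f (G f))"
  using Cn.Re_cip_nonneg[of "L f"] by (simp add: cip_frame_op del: Cn_simps(3))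

text \<open>
  For \<open>Q = |q\<rangle>\<langle>q|\<close> the operator \<open>Q \<Phi>(X)\<close> is \<open>|q\<rangle>\<langle>L q|\<close>, so its squared Hilbert--Schmidt norm is
  \<open>|L q|\<^sup>2 = \<langle>q, G q\<rangle>\<close>. The trace of \<open>Q G\<close> below has the same value, hence both maximum problems are about
  the Rayleigh quotient of \<open>G\<close>.
\<close>

lemma hs_norm_projected_synthesis:
  assumes q: "q \<in> vecs H" "nrm q = 1" and Q: "\<And>f. f \<in> vecs H \<Longrightarrow> Q f = ketbra H q q f"
  shows "(hs_norm Cn H (Q \<circ> PhiX))\<^sup>2 = Re (cip H q (G q))"
proof -
  have "hs_norm Cn H (Q \<circ> PhiX) = sqrt (Re (cip Cn (L q) (L q)))"
  proof (rule Cn.hs_norm_eqI[where A' = "\<lambda>f. L (ketbra H q q f)"])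
    fix f and c :: "complex ^ 'n" assume f: "f \<in> vecs H"
    have k: "ketbra H q q f \<in> vecs H" using q by (simp add: ketbra_def)
    have "cip Cn (L (ketbra H q q f)) c = cip H (ketbra H q q f) (PhiX c)"
      using k by (simp only: cip_synthesis_op)
    then show "cip Cn (L (ketbra H q q f)) c = cip H f ((Q \<circ> PhiX) c)"
      using q f by (simp add: Q ketbra_def cip_scal_left cip_scal_right cnj_cip mult.commute del: Cn_simps(3))
  next
    fix B assume B: "orthonormal_basis (Cn :: (complex ^ 'n) ips) B"
    have "cip H ((Q \<circ> PhiX) e) ((Q \<circ> PhiX) e) = cip Cn (L q) e * cip Cn e (L q)" for e
    proof -
      have "cip H q (PhiX e) = cip Cn (L q) e" "cip H (PhiX e) q = cip Cn e (L q)"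
        using q cnj_cip[of q "PhiX e"] Cn.cnj_cip[of "L q" e]
        by (simp_all add: cip_synthesis_op del: Cn_simps(3))
      then show ?thesis
        using q cip_self[OF q(1)] Cn.cnj_cip[of "L q" e]
        by (simp add: Q ketbra_def cip_scal_left cip_scal_right cnj_cip del: Cn_simps(3))
    qed
    then show "((\<lambda>e. cip H ((Q \<circ> PhiX) e) ((Q \<circ> PhiX) e)) has_sum cip Cn (L q) (L q)) B"
      using Cn.parseval[OF B, of "L q" "L q"] by (simp del: Cn_simps(3) comp_apply)
  qed (use q Q in \<open>auto simp: ketbra_def intro: orthonormal_basis_Cn semi_inner_space_axioms\<close>)
  then show ?thesis
    using Re_cip_frame_op_nonneg[OF q(1)] cip_frame_op[OF q(1), of q] by simp
qed

lemma op_trace_projected_frame: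
  assumes q: "q \<in> vecs H" and Q: "\<And>f. f \<in> vecs H \<Longrightarrow> Q f = ketbra H q q f"
  shows "op_trace H (Q \<circ> G) = cip H q (G q)"
proof (rule op_trace_eqI[OF orthonormal_basis_exists])
  fix B assume B: "orthonormal_basis H B"
  have "cip H e ((Q \<circ> G) e) = cip H (G q) e * cip H e q" if "e \<in> B" for e
    using orthonormal_basis_vecs[OF B that] q
    by (simp add: Q ketbra_def cip_scal_right frame_op_selfadjoint)
  then show "((\<lambda>e. cip H e ((Q \<circ> G) e)) has_sum cip H q (G q)) B"
    using parseval[OF B frame_op_vecs[of q] q] frame_op_selfadjoint[OF q q]
    by (subst has_sum_cong) auto
qed

text \<open>
  The squared Hilbert--Schmidt norm of \<open>G\<close>, which enters the minimum problem as an additive constant. Writing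
  \<open>|G e|\<^sup>2 = \<langle>L e, L (G e)\<rangle>\<close> splits it into finitely many Parseval sums.
\<close>

lemma has_sum_frame_op_sq:
  assumes B: "orthonormal_basis H B"
  shows "((\<lambda>e. cip H (G e) (G e)) has_sum (\<Sum>j\<in>UNIV. cip H (\<Phi> (x j)) (G (\<Phi> (x j))))) B"
proof -
  have "cip H (G e) (G e) = (\<Sum>j\<in>UNIV. cip H (\<Phi> (x j)) e * cip H e (G (\<Phi> (x j))))" if "e \<in> B" for e
  proof -
    have e: "e \<in> vecs H" using orthonormal_basis_vecs[OF B that] .
    have "cip H (G e) (G e) = cip H e (G (G e))" using e by (simp add: frame_op_selfadjoint)
    also have "\<dots> = (\<Sum>j\<in>UNIV. cnj (L e $ j) * L (G e) $ j)" using e by (simp add: cip_frame_op)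
    also have "\<dots> = (\<Sum>j\<in>UNIV. cip H e (\<Phi> (x j)) * cip H (G (\<Phi> (x j))) e)"
      using e by (simp add: analysis_op_nth cnj_cip frame_op_selfadjoint)
    finally have *: "cip H (G e) (G e) = (\<Sum>j\<in>UNIV. cip H e (\<Phi> (x j)) * cip H (G (\<Phi> (x j))) e)" .
    have "cnj (cip H (G e) (G e)) = (\<Sum>j\<in>UNIV. cip H (\<Phi> (x j)) e * cip H e (G (\<Phi> (x j))))"
      unfolding * using e by (simp add: cnj_cip)
    then show ?thesis by (simp add: cnj_cip)
  qed
  moreover have "((\<lambda>e. \<Sum>j\<in>UNIV. cip H (\<Phi> (x j)) e * cip H e (G (\<Phi> (x j))))
      has_sum (\<Sum>j\<in>UNIV. cip H (\<Phi> (x j)) (G (\<Phi> (x j))))) B"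
    by (intro has_sum_finite_sum parseval B) auto
  ultimately show ?thesis by (subst has_sum_cong) auto
qed

text \<open>
  Expanding the square gives \<open>|G|\<^sup>2 - 2 Re \<langle>v, G u\<rangle> + |v|\<^sup>2\<close> for \<open>A = |u\<rangle>\<langle>v|\<close> with a unit vector \<open>u\<close>, and
  completing the square in \<open>v\<close> separates the two tasks: choose \<open>v = G u\<close>, and make \<open>|G u|\<close> as large as possible.
\<close>

lemma hs_norm_frame_op_diff_ketbra:
  assumes u: "u \<in> vecs H" "nrm u = 1" and v: "v \<in> vecs H"
    and A: "\<And>f. f \<in> vecs H \<Longrightarrow> A f = ketbra H u v f"
  shows "hs_norm H H (\<lambda>f. G f - A f) =
    sqrt (Re (\<Sum>j\<in>UNIV. cip H (\<Phi> (x j)) (G (\<Phi> (x j)))) - (nrm (G u))\<^sup>2 + (nrm (v - G u))\<^sup>2)"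
proof -
  let ?\<tau> = "\<Sum>j\<in>UNIV. cip H (\<Phi> (x j)) (G (\<Phi> (x j)))"
  have uu: "cip H u u = 1" using cip_self[OF u(1)] u by simp
  have "hs_norm H H (\<lambda>f. G f - A f) =
      sqrt (Re (?\<tau> + - cip H v (G u) + - cip H (G u) v + cip H v v))"
  proof (rule hs_norm_eqI[where A' = "\<lambda>g. G g - ketbra H v u g"])
    fix B assume B: "orthonormal_basis H B"
    let ?a = "\<lambda>e. cip H (G e) (G e)" and ?b = "\<lambda>e. cip H v e * cip H e (G u)"
      and ?c = "\<lambda>e. cip H (G u) e * cip H e v" and ?d = "\<lambda>e. cip H v e * cip H e v"
    have "cip H (G e - A e) (G e - A e) = ?a e + - ?b e + - ?c e + ?d e" if "e \<in> B" for e
    proof -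
      have e: "e \<in> vecs H" using orthonormal_basis_vecs[OF B that] .
      have Ae: "A e = scal H (cip H v e) u" using A[OF e] by (simp add: ketbra_def)
      have "cip H (G e) (A e) = ?b e" "cip H (A e) (A e) = ?d e"
        using e u v uu by (simp_all add: Ae cip_scal_right cip_scal_left frame_op_selfadjoint cnj_cip)
      moreover have "cip H (A e) (G e) = ?c e"
        using e u v by (simp add: Ae cip_scal_left frame_op_selfadjoint cnj_cip)
      moreover have "cip H (G e - A e) (G e - A e) =
          ?a e + - cip H (G e) (A e) + - cip H (A e) (G e) + cip H (A e) (A e)"
        using e u by (simp add: Ae cip_diff_left cip_diff_right)
      ultimately show ?thesis by simp
    qed
    moreover have "((\<lambda>e. ?a e + - ?b e + - ?c e + ?d e)
        has_sum (?\<tau> + - cip H v (G u) + - cip H (G u) v + cip H v v)) B"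
      using u v parseval[OF B]
      by (intro has_sum_add has_sum_frame_op_sq[OF B]) (auto simp: has_sum_uminus)
    ultimately show "((\<lambda>e. cip H (G e - A e) (G e - A e))
        has_sum (?\<tau> + - cip H v (G u) + - cip H (G u) v + cip H v v)) B"
      by (subst has_sum_cong) auto
  qed (use u v in \<open>auto simp: A ketbra_def cip_lin cnj_cip frame_op_selfadjoint mult.commute
      intro: orthonormal_basis_exists semi_inner_space_axioms\<close>)
  also have "Re (?\<tau> + - cip H v (G u) + - cip H (G u) v + cip H v v)
      = Re ?\<tau> - (nrm (G u))\<^sup>2 + (nrm (v - G u))\<^sup>2"
    using v u cnj_cip[OF v frame_op_vecs[of u], symmetric] by (simp add: nrm_sq_diff nrm_sq[OF v])
  finally show ?thesis .
qed

end

section \<open>The spectral representation and its extremal problems\<close>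

locale spectral_frame = sampled_features +
  fixes N :: enat and lam :: "nat \<Rightarrow> real" and \<phi> :: "nat \<Rightarrow> 'a"
  assumes N: "1 \<le> N" and spectral: "spectral_representation H (frame_op H \<Phi> x) N lam \<phi>"
begin

lemma one_in_index: "1 \<in> index_set N"
  using N by (simp add: index_set_def one_enat_def)

lemma \<phi>_vecs [simp]: "j \<in> index_set N \<Longrightarrow> \<phi> j \<in> vecs H"
  and \<phi>_orthonormal: "i \<in> index_set N \<Longrightarrow> j \<in> index_set N \<Longrightarrow> cip H (\<phi> i) (\<phi> j) = (if i = j then 1 else 0)"
  and lam_antimono: "i \<in> index_set N \<Longrightarrow> j \<in> index_set N \<Longrightarrow> i \<le> j \<Longrightarrow> (lam j)\<^sup>2 \<le> (lam i)\<^sup>2"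
  using spectral unfolding spectral_representation_def by blast+

lemma nrm_\<phi>: "j \<in> index_set N \<Longrightarrow> nrm (\<phi> j) = 1"
  using \<phi>_orthonormal[of j j] by (simp add: ips_norm_def)

definition partial_frame :: "nat set \<Rightarrow> 'a \<Rightarrow> 'a" where
  "partial_frame F f = (\<Sum>j\<in>F. scal H (of_real ((lam j)\<^sup>2)) (ketbra H (\<phi> j) (\<phi> j) f))"

text \<open>
  The spectral sum converges strongly; inside an inner product it becomes a net of finite scalar
  sums, which can be estimated term by term before passing to the limit.
\<close>

lemma tendsto_cip_partial_frame:
  assumes "f \<in> vecs H" "g \<in> vecs H"
  shows "((\<lambda>F. \<Sum>j\<in>F. of_real ((lam j)\<^sup>2) * cip H (\<phi> j) g * cip H f (\<phi> j)) \<longlongrightarrow> cip H f (G g))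
    (finite_subsets_at_top (index_set N))"
proof -
  have mem: "partial_frame F g \<in> vecs H" if "F \<subseteq> index_set N" for F
    unfolding partial_frame_def ketbra_def using that by (intro sum_vecs scal_vecs) auto
  have ev: "\<forall>\<^sub>F F in finite_subsets_at_top (index_set N). F \<subseteq> index_set N"
    by (rule eventually_finite_subsets_at_top_weakI)
  have "((\<lambda>F. cip H f (partial_frame F g) - cip H f (G g)) \<longlongrightarrow> 0) (finite_subsets_at_top (index_set N))"
  proof (rule Lim_null_comparison)
    show "\<forall>\<^sub>F F in finite_subsets_at_top (index_set N).
        norm (cip H f (partial_frame F g) - cip H f (G g)) \<le> nrm f * nrm (G g - partial_frame F g)"
      using ev
    proof eventually_elim
      case (elim F)
      have "norm (cip H f (partial_frame F g) - cip H f (G g)) = norm (cip H f (G g - partial_frame F g))"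
        using assms mem[OF elim] by (simp add: cip_diff_right norm_minus_commute)
      then show ?case using assms mem[OF elim] by (simp add: Cauchy_Schwarz)
    qed
    show "((\<lambda>F. nrm f * nrm (G g - partial_frame F g)) \<longlongrightarrow> 0) (finite_subsets_at_top (index_set N))"
      using spectral assms unfolding spectral_representation_def partial_frame_def
      by (intro tendsto_mult_right_zero) blast
  qed
  then have "((\<lambda>F. cip H f (partial_frame F g)) \<longlongrightarrow> cip H f (G g)) (finite_subsets_at_top (index_set N))"
    by (rule LIM_zero_cancel)
  then show ?thesis
  proof (rule Lim_transform_eventually)
    show "\<forall>\<^sub>F F in finite_subsets_at_top (index_set N). cip H f (partial_frame F g) =
        (\<Sum>j\<in>F. of_real ((lam j)\<^sup>2) * cip H (\<phi> j) g * cip H f (\<phi> j))"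
      using ev
    proof eventually_elim
      case (elim F)
      then have "\<phi> j \<in> vecs H" if "j \<in> F" for j using that by auto
      then show ?case unfolding partial_frame_def ketbra_def using assms
        by (subst cip_sum_right) (auto simp: cip_scal_right mult.assoc intro!: sum.cong)
    qed
  qed
qed

lemma eigenvector: "j \<in> index_set N \<Longrightarrow> G (\<phi> j) = scal H (of_real ((lam j)\<^sup>2)) (\<phi> j)"
proof (rule cip_ext_right)
  assume j: "j \<in> index_set N"
  fix f assume f: "f \<in> vecs H"
  have "((\<lambda>F. \<Sum>i\<in>F. of_real ((lam i)\<^sup>2) * cip H (\<phi> i) (\<phi> j) * cip H f (\<phi> i))
      \<longlongrightarrow> of_real ((lam j)\<^sup>2) * cip H f (\<phi> j)) (finite_subsets_at_top (index_set N))"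
  proof (rule tendsto_eventually)
    have "\<forall>\<^sub>F F in finite_subsets_at_top (index_set N). finite F \<and> {j} \<subseteq> F \<and> F \<subseteq> index_set N"
      unfolding eventually_finite_subsets_at_top by (rule exI[of _ "{j}"]) (use j in auto)
    then show "\<forall>\<^sub>F F in finite_subsets_at_top (index_set N).
        (\<Sum>i\<in>F. of_real ((lam i)\<^sup>2) * cip H (\<phi> i) (\<phi> j) * cip H f (\<phi> i)) =
        of_real ((lam j)\<^sup>2) * cip H f (\<phi> j)"
    proof eventually_elim
      case (elim F)
      have "(\<Sum>i\<in>F. of_real ((lam i)\<^sup>2) * cip H (\<phi> i) (\<phi> j) * cip H f (\<phi> i)) =
          (\<Sum>i\<in>F. if i = j then of_real ((lam i)\<^sup>2) * cip H f (\<phi> i) else 0)"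
        using elim j by (intro sum.cong) (auto simp: \<phi>_orthonormal subset_iff)
      then show ?case using elim by simp
    qed
  qed
  then have "cip H f (G (\<phi> j)) = of_real ((lam j)\<^sup>2) * cip H f (\<phi> j)"
    by (intro tendsto_unique[OF finite_subsets_at_top_neq_bot
          tendsto_cip_partial_frame[OF f \<phi>_vecs[OF j]]])
  then show "cip H f (G (\<phi> j)) = cip H f (scal H (of_real ((lam j)\<^sup>2)) (\<phi> j))"
    using f j by (simp add: cip_scal_right)
qed (simp_all)

lemma tendsto_frame_form:
  assumes f: "f \<in> vecs H"
  shows "((\<lambda>F. \<Sum>j\<in>F. (lam j)\<^sup>2 * (cmod (cip H (\<phi> j) f))\<^sup>2) \<longlongrightarrow> Re (cip H f (G f)))
    (finite_subsets_at_top (index_set N))"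
proof (rule Lim_transform_eventually[OF tendsto_Re[OF tendsto_cip_partial_frame[OF f f]]])
  have "\<forall>\<^sub>F F in finite_subsets_at_top (index_set N). F \<subseteq> index_set N"
    by (rule eventually_finite_subsets_at_top_weakI)
  then show "\<forall>\<^sub>F F in finite_subsets_at_top (index_set N).
      Re (\<Sum>j\<in>F. of_real ((lam j)\<^sup>2) * cip H (\<phi> j) f * cip H f (\<phi> j)) =
      (\<Sum>j\<in>F. (lam j)\<^sup>2 * (cmod (cip H (\<phi> j) f))\<^sup>2)"
  proof eventually_elim
    case (elim F)
    have summand: "of_real ((lam j)\<^sup>2) * cip H (\<phi> j) f * cip H f (\<phi> j) =
        of_real ((lam j)\<^sup>2 * (cmod (cip H (\<phi> j) f))\<^sup>2)" if "j \<in> F" for j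
    proof -
      have "cip H f (\<phi> j) = cnj (cip H (\<phi> j) f)" using that elim f by (simp add: cnj_cip subset_iff)
      then show ?thesis by (simp only: mult.assoc mult_cnj_norm of_real_mult)
    qed
    show ?case unfolding Re_sum by (intro sum.cong refl) (simp only: summand Re_complex_of_real)
  qed
qed

text \<open>
  If \<open>\<mu>\<close> bounds all eigenvalues but the first, then \<open>\<langle>f, G f\<rangle>\<close> is at most \<open>\<mu> |f|\<^sup>2\<close> plus the excess
  \<open>\<lambda>\<^sub>1\<^sup>2 - \<mu>\<close> times the squared first coefficient. With \<open>\<mu> = \<lambda>\<^sub>1\<^sup>2\<close> this bounds the Rayleigh quotient, and with
  \<open>\<mu> < \<lambda>\<^sub>1\<^sup>2\<close> it controls the maximizers. Bessel's inequality takes care of a family \<open>\<phi>\<close> that is not complete.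
\<close>

lemma frame_form_gap:
  assumes f: "f \<in> vecs H" and \<mu>: "0 \<le> \<mu>" "\<And>j. j \<in> index_set N \<Longrightarrow> j \<noteq> 1 \<Longrightarrow> (lam j)\<^sup>2 \<le> \<mu>"
  shows "Re (cip H f (G f)) \<le> \<mu> * (nrm f)\<^sup>2 + ((lam 1)\<^sup>2 - \<mu>) * (cmod (cip H (\<phi> 1) f))\<^sup>2"
proof (rule tendsto_upperbound[OF tendsto_frame_form[OF f]])
  have "\<forall>\<^sub>F F in finite_subsets_at_top (index_set N). finite F \<and> {1} \<subseteq> F \<and> F \<subseteq> index_set N"
    unfolding eventually_finite_subsets_at_top by (rule exI[of _ "{1}"]) (use one_in_index in auto)
  then show "\<forall>\<^sub>F F in finite_subsets_at_top (index_set N).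
    (\<Sum>j\<in>F. (lam j)\<^sup>2 * (cmod (cip H (\<phi> j) f))\<^sup>2)
      \<le> \<mu> * (nrm f)\<^sup>2 + ((lam 1)\<^sup>2 - \<mu>) * (cmod (cip H (\<phi> 1) f))\<^sup>2"
  proof eventually_elim
    case (elim F)
    then have F: "finite F" "1 \<in> F" "\<And>j. j \<in> F \<Longrightarrow> j \<in> index_set N" by auto
    let ?c = "\<lambda>j. (cmod (cip H (\<phi> j) f))\<^sup>2"
    have "(\<Sum>j\<in>F. (lam j)\<^sup>2 * ?c j) \<le> (\<Sum>j\<in>F. \<mu> * ?c j + (if j = 1 then ((lam 1)\<^sup>2 - \<mu>) * ?c 1 else 0))"
    proof (intro sum_mono)
      fix j assume "j \<in> F"
      then show "(lam j)\<^sup>2 * ?c j \<le> \<mu> * ?c j + (if j = 1 then ((lam 1)\<^sup>2 - \<mu>) * ?c 1 else 0)"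
        using \<mu>(2)[of j] F(3) by (cases "j = 1") (auto simp: algebra_simps intro: mult_right_mono)
    qed
    also have "\<dots> = \<mu> * (\<Sum>j\<in>F. ?c j) + ((lam 1)\<^sup>2 - \<mu>) * ?c 1"
      using F by (simp add: sum.distrib sum_distrib_left)
    also have "\<dots> \<le> \<mu> * (nrm f)\<^sup>2 + ((lam 1)\<^sup>2 - \<mu>) * ?c 1"
      using F f \<mu>(1) by (intro add_right_mono mult_left_mono bessel_inequality) (auto simp: \<phi>_orthonormal)
    finally show ?case .
  qed
qed (rule finite_subsets_at_top_neq_bot)

lemma frame_form_le:
  assumes f: "f \<in> vecs H"
  shows "Re (cip H f (G f)) \<le> (lam 1)\<^sup>2 * (nrm f)\<^sup>2"
proof -
  have "(lam j)\<^sup>2 \<le> (lam 1)\<^sup>2" if "j \<in> index_set N" for j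
    by (rule lam_antimono[OF one_in_index that]) (use that in \<open>simp add: index_set_def\<close>)
  from frame_form_gap[OF f zero_le_power2 this] show ?thesis by simp
qed

text \<open>
  In the eigenvectors this compares \<open>\<lambda>\<^sub>j\<^sup>4\<close> with \<open>\<lambda>\<^sub>1\<^sup>2 \<lambda>\<^sub>j\<^sup>2\<close>. It reduces the size of \<open>|G u|\<close> in the minimum problem
  to the Rayleigh quotient.
\<close>

lemma nrm_frame_op_sq_le:
  assumes f: "f \<in> vecs H"
  shows "(nrm (G f))\<^sup>2 \<le> (lam 1)\<^sup>2 * Re (cip H f (G f))"
  unfolding nrm_sq[OF frame_op_vecs]
proof (rule tendsto_le[OF _ tendsto_mult_left[OF tendsto_frame_form[OF f]]
      tendsto_Re[OF tendsto_cip_partial_frame[OF frame_op_vecs f]]])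
  have "\<forall>\<^sub>F F in finite_subsets_at_top (index_set N). F \<subseteq> index_set N"
    by (rule eventually_finite_subsets_at_top_weakI)
  then show "\<forall>\<^sub>F F in finite_subsets_at_top (index_set N).
      Re (\<Sum>j\<in>F. of_real ((lam j)\<^sup>2) * cip H (\<phi> j) f * cip H (G f) (\<phi> j))
      \<le> (lam 1)\<^sup>2 * (\<Sum>j\<in>F. (lam j)\<^sup>2 * (cmod (cip H (\<phi> j) f))\<^sup>2)"
  proof eventually_elim
    case (elim F)
    have "Re (of_real ((lam j)\<^sup>2) * cip H (\<phi> j) f * cip H (G f) (\<phi> j))
        \<le> (lam 1)\<^sup>2 * ((lam j)\<^sup>2 * (cmod (cip H (\<phi> j) f))\<^sup>2)" if "j \<in> F" for j
    proof -
      have j: "j \<in> index_set N" "1 \<le> j" using that elim by (auto simp: index_set_def)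
      have "cip H (G f) (\<phi> j) = of_real ((lam j)\<^sup>2) * cnj (cip H (\<phi> j) f)"
        using f j by (simp add: frame_op_selfadjoint eigenvector cip_scal_right cnj_cip)
      then have "of_real ((lam j)\<^sup>2) * cip H (\<phi> j) f * cip H (G f) (\<phi> j) =
          of_real ((lam j)\<^sup>2 * (lam j)\<^sup>2) * (cip H (\<phi> j) f * cnj (cip H (\<phi> j) f))"
        by simp
      also have "\<dots> = of_real ((lam j)\<^sup>2 * ((lam j)\<^sup>2 * (cmod (cip H (\<phi> j) f))\<^sup>2))"
        by (simp only: mult_cnj_norm of_real_mult mult.assoc)
      finally have eq: "Re (of_real ((lam j)\<^sup>2) * cip H (\<phi> j) f * cip H (G f) (\<phi> j)) =
          (lam j)\<^sup>2 * ((lam j)\<^sup>2 * (cmod (cip H (\<phi> j) f))\<^sup>2)" by simp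
      show ?thesis
        unfolding eq by (rule mult_right_mono) (use lam_antimono[OF one_in_index j] in auto)
    qed
    then show ?case by (simp only: Re_sum sum_distrib_left) (rule sum_mono)
  qed
qed (rule finite_subsets_at_top_neq_bot)

text \<open>
  With a spectral gap the bound on the Rayleigh quotient is attained only if the first coefficient of \<open>q\<close>
  has modulus one, that is, only at \<open>\<phi> 1\<close> up to a phase.
\<close>

lemma maximizer_unique:
  assumes simple: "top_eigenvalue_simple N lam" and q: "q \<in> vecs H" "nrm q = 1"
    and ge: "(lam 1)\<^sup>2 \<le> Re (cip H q (G q))" and f: "f \<in> vecs H"
  shows "ketbra H q q f = ketbra H (\<phi> 1) (\<phi> 1) f"
proof -
  \<comment> \<open>The second eigenvalue, or zero if there is none.\<close>
  define \<mu> where "\<mu> = (if 2 \<in> index_set N then (lam 2)\<^sup>2 else 0)"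
  have \<mu>: "0 \<le> \<mu>" "\<mu> < (lam 1)\<^sup>2"
    using simple unfolding \<mu>_def top_eigenvalue_simple_def by simp_all
  have le: "(lam j)\<^sup>2 \<le> \<mu>" if j: "j \<in> index_set N" "j \<noteq> 1" for j
  proof -
    have "2 \<le> j" using j by (auto simp: index_set_def)
    then have "enat 2 \<le> enat j" by simp
    moreover have "enat j \<le> N" using j by (simp add: index_set_def)
    ultimately have "enat 2 \<le> N" by (rule order_trans)
    then have "2 \<in> index_set N" by (simp add: index_set_def)
    then show ?thesis using lam_antimono[OF _ j(1) \<open>2 \<le> j\<close>] by (simp add: \<mu>_def)
  qed
  have "(lam 1)\<^sup>2 \<le> \<mu> + ((lam 1)\<^sup>2 - \<mu>) * (cmod (cip H (\<phi> 1) q))\<^sup>2"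
    using frame_form_gap[OF q(1) \<mu>(1) le] ge q by simp
  then have "((lam 1)\<^sup>2 - \<mu>) * 1 \<le> ((lam 1)\<^sup>2 - \<mu>) * (cmod (cip H (\<phi> 1) q))\<^sup>2" by simp
  then have "1 \<le> (cmod (cip H (\<phi> 1) q))\<^sup>2"
    using \<mu>(2) by (subst (asm) mult_le_cancel_left_pos) auto
  then show ?thesis
    using \<phi>_vecs[OF one_in_index] nrm_\<phi>[OF one_in_index] q f by (intro ketbra_unit_phase)
qed

lemma top_frame_form: "Re (cip H (\<phi> 1) (G (\<phi> 1))) = (lam 1)\<^sup>2"
  unfolding eigenvector[OF one_in_index] cip_scal_right[OF \<phi>_vecs[OF one_in_index] \<phi>_vecs[OF one_in_index]]
  using \<phi>_orthonormal[OF one_in_index one_in_index] by simp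

text \<open>
  Admissible operators are the projections \<open>|q\<rangle>\<langle>q|\<close> on unit vectors, so any functional that takes the value
  \<open>\<langle>q, G q\<rangle>\<close> on them is maximized at the top eigenvector.
\<close>

lemma realizes_max_top_projection:
  assumes J: "\<And>Q q. q \<in> vecs H \<Longrightarrow> nrm q = 1 \<Longrightarrow> (\<And>f. f \<in> vecs H \<Longrightarrow> Q f = ketbra H q q f) \<Longrightarrow>
    J Q = Re (cip H q (G q))"
  shows "realizes_max H (top_eigenvalue_simple N lam) J
    (\<lambda>Q. (hs_norm H H Q)\<^sup>2 = 1 \<and> selfadjoint_projection H Q) (ketbra H (\<phi> 1) (\<phi> 1))"
proof -
  let ?P = "\<lambda>Q. (hs_norm H H Q)\<^sup>2 = 1 \<and> selfadjoint_projection H Q"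
  note \<phi>1 = \<phi>_vecs[OF one_in_index] nrm_\<phi>[OF one_in_index]
  have P: "?P (ketbra H (\<phi> 1) (\<phi> 1))"
    by (intro conjI ketbra_selfadjoint_projection \<phi>1) (simp only: ketbra_unit_hs_norm[OF \<phi>1] power_one)
  have J1: "J (ketbra H (\<phi> 1) (\<phi> 1)) = (lam 1)\<^sup>2"
    unfolding top_frame_form[symmetric] by (rule J[OF \<phi>1]) (rule refl)
  have le: "J Q \<le> (lam 1)\<^sup>2" if "?P Q" for Q
  proof -
    obtain q where q: "q \<in> vecs H" "nrm q = 1" "\<And>f. f \<in> vecs H \<Longrightarrow> Q f = ketbra H q q f"
      by (rule projection_of_unit_hs_norm[of Q]) (use \<open>?P Q\<close> in auto)
    have "J Q = Re (cip H q (G q))" by (rule J[OF q(1,2)]) (rule q(3))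
    then show ?thesis using frame_form_le[OF q(1)] q(2) by simp
  qed
  have uniq: "op_eq H Q (ketbra H (\<phi> 1) (\<phi> 1))"
    if simple: "top_eigenvalue_simple N lam" and Q: "?P Q" and ge: "(lam 1)\<^sup>2 \<le> J Q" for Q
  proof -
    obtain q where q: "q \<in> vecs H" "nrm q = 1" "\<And>f. f \<in> vecs H \<Longrightarrow> Q f = ketbra H q q f"
      by (rule projection_of_unit_hs_norm[of Q]) (use Q in auto)
    have "J Q = Re (cip H q (G q))" by (rule J[OF q(1,2)]) (rule q(3))
    then have "(lam 1)\<^sup>2 \<le> Re (cip H q (G q))" using ge by (simp only:)
    then show ?thesis unfolding op_eq_def using maximizer_unique[OF simple q(1,2)] q(3) by simp
  qed
  show ?thesis
    unfolding realizes_max_def is_arg_max_def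
    using P J1 le uniq by (metis not_le)
qed

text \<open>
  For \<open>A = |u\<rangle>\<langle>v|\<close> the squared error is \<open>\<tau> - |G u|\<^sup>2 + |v - G u|\<^sup>2\<close>, and \<open>|G u|\<^sup>2 \<le> \<lambda>\<^sub>1\<^sup>2 \<langle>u, G u\<rangle> \<le> \<lambda>\<^sub>1\<^sup>4\<close>.
  Both inequalities are equalities for \<open>u = \<phi> 1\<close>, \<open>v = G u\<close>. Conversely a minimizer satisfies \<open>v = G u\<close>, and if
  the top eigenvalue is simple, \<open>u\<close> maximizes the Rayleigh quotient, which determines \<open>|u\<rangle>\<langle>u|\<close> and hence
  \<open>A = |u\<rangle>\<langle>u| G\<close>.
\<close>

lemma realizes_min_top_truncation:
  "realizes_min H (top_eigenvalue_simple N lam) (\<lambda>A. hs_norm H H (\<lambda>f. G f - A f))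
    (\<lambda>A. bounded_op H H A \<and> rank_le_one H H A)
    (\<lambda>f. scal H (of_real ((lam 1)\<^sup>2)) (ketbra H (\<phi> 1) (\<phi> 1) f))"
proof -
  let ?P = "\<lambda>A. bounded_op H H A \<and> rank_le_one H H A"
  let ?J = "\<lambda>A. hs_norm H H (\<lambda>f. G f - A f)"
  let ?T = "\<lambda>f. scal H (of_real ((lam 1)\<^sup>2)) (ketbra H (\<phi> 1) (\<phi> 1) f)"
  define \<tau> where "\<tau> = Re (\<Sum>j\<in>UNIV. cip H (\<Phi> (x j)) (G (\<Phi> (x j))))"
  note \<phi>1 = \<phi>_vecs[OF one_in_index] nrm_\<phi>[OF one_in_index]
  have "bounded_op H H (ketbra H (\<phi> 1) (\<phi> 1))"
    using ketbra_selfadjoint_projection[OF \<phi>1] unfolding selfadjoint_projection_def by (rule conjunct1)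
  then obtain M where M: "\<And>f. f \<in> vecs H \<Longrightarrow> nrm (ketbra H (\<phi> 1) (\<phi> 1) f) \<le> M * nrm f"
    unfolding bounded_op_def by blast
  have bdT: "bounded_op H H ?T"
    unfolding bounded_op_def
  proof (intro conjI ballI allI exI[of _ "(lam 1)\<^sup>2 * M"])
    fix f assume f: "f \<in> vecs H"
    then show "nrm (?T f) \<le> (lam 1)\<^sup>2 * M * nrm f"
      using M[OF f] \<phi>1(1) by (simp add: ketbra_def nrm_scal norm_power mult.assoc mult_left_mono
          del: scal_scal)
  qed (use \<phi>1(1) in \<open>auto simp: ketbra_def cip_add_right cip_scal_right scal_add_left
      scal_add_right distrib_left mult_ac\<close>)
  have "rank_le_one H H ?T"
    unfolding rank_le_one_def using \<phi>1(1) by (auto simp: ketbra_def intro!: bexI[of _ "\<phi> 1"])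
  with bdT have P: "?P ?T" by blast
  have G1: "G (\<phi> 1) = scal H (of_real ((lam 1)\<^sup>2)) (\<phi> 1)" by (rule eigenvector[OF one_in_index])
  have nG1: "(nrm (G (\<phi> 1)))\<^sup>2 = ((lam 1)\<^sup>2)\<^sup>2"
    using \<phi>1 unfolding G1 by (simp add: nrm_scal norm_power)
  have "?J ?T = sqrt (\<tau> - (nrm (G (\<phi> 1)))\<^sup>2 + (nrm (G (\<phi> 1) - G (\<phi> 1)))\<^sup>2)"
    unfolding \<tau>_def
    by (rule hs_norm_frame_op_diff_ketbra) (use \<phi>1 in \<open>simp_all add: G1 ketbra_def cip_scal_left del: One_nat_def\<close>)
  then have JT: "?J ?T = sqrt (\<tau> - ((lam 1)\<^sup>2)\<^sup>2)" unfolding nG1 by simp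
  have JA: "?J A = sqrt (\<tau> - (nrm (G u))\<^sup>2 + (nrm (v - G u))\<^sup>2)"
    if "u \<in> vecs H" "nrm u = 1" "v \<in> vecs H" "\<And>f. f \<in> vecs H \<Longrightarrow> A f = ketbra H u v f" for A u v
    unfolding \<tau>_def using that by (rule hs_norm_frame_op_diff_ketbra)
  have sq: "(nrm (G u))\<^sup>2 \<le> (lam 1)\<^sup>2 * Re (cip H u (G u))" "Re (cip H u (G u)) \<le> (lam 1)\<^sup>2"
    "(nrm (G u))\<^sup>2 \<le> ((lam 1)\<^sup>2)\<^sup>2"
    if u: "u \<in> vecs H" "nrm u = 1" for u
  proof -
    show 1: "(nrm (G u))\<^sup>2 \<le> (lam 1)\<^sup>2 * Re (cip H u (G u))" by (rule nrm_frame_op_sq_le[OF u(1)])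
    show 2: "Re (cip H u (G u)) \<le> (lam 1)\<^sup>2" using frame_form_le[OF u(1)] u by simp
    have "(lam 1)\<^sup>2 * Re (cip H u (G u)) \<le> (lam 1)\<^sup>2 * (lam 1)\<^sup>2"
      using 2 by (intro mult_left_mono) auto
    with 1 show "(nrm (G u))\<^sup>2 \<le> ((lam 1)\<^sup>2)\<^sup>2" by (simp add: power2_eq_square)
  qed
  have le: "?J ?T \<le> ?J A" if A: "?P A" for A
  proof -
    obtain u v where uv: "u \<in> vecs H" "nrm u = 1" "v \<in> vecs H" "\<And>f. f \<in> vecs H \<Longrightarrow> A f = ketbra H u v f"
      using rank_le_one_ketbra[OF conjunct1[OF A] conjunct2[OF A] \<phi>1] by blast
    have JAuv: "?J A = sqrt (\<tau> - (nrm (G u))\<^sup>2 + (nrm (v - G u))\<^sup>2)"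
      by (rule JA[OF uv(1-3)]) (rule uv(4))
    have "\<tau> - ((lam 1)\<^sup>2)\<^sup>2 \<le> \<tau> - (nrm (G u))\<^sup>2 + (nrm (v - G u))\<^sup>2"
      using sq(3)[OF uv(1,2)] zero_le_power2[of "nrm (v - G u)"] by linarith
    then show ?thesis unfolding JT JAuv by (rule real_sqrt_le_mono)
  qed
  have uniq: "op_eq H A ?T"
    if simple: "top_eigenvalue_simple N lam" and A: "?P A" and JA_le: "?J A \<le> ?J ?T" for A
  proof -
    have pos: "0 < (lam 1)\<^sup>2" using simple by (simp add: top_eigenvalue_simple_def)
    obtain u v where uv: "u \<in> vecs H" "nrm u = 1" "v \<in> vecs H" "\<And>f. f \<in> vecs H \<Longrightarrow> A f = ketbra H u v f"
      using rank_le_one_ketbra[OF conjunct1[OF A] conjunct2[OF A] \<phi>1] by blast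
    have JAuv: "?J A = sqrt (\<tau> - (nrm (G u))\<^sup>2 + (nrm (v - G u))\<^sup>2)"
      by (rule JA[OF uv(1-3)]) (rule uv(4))
    have "\<tau> - (nrm (G u))\<^sup>2 + (nrm (v - G u))\<^sup>2 \<le> \<tau> - ((lam 1)\<^sup>2)\<^sup>2"
      using JA_le unfolding JT JAuv by simp
    then have eqs: "(nrm (v - G u))\<^sup>2 = 0" "(nrm (G u))\<^sup>2 = ((lam 1)\<^sup>2)\<^sup>2"
      using sq(3)[OF uv(1,2)] zero_le_power2[of "nrm (v - G u)"] by linarith+
    have v: "v = G u" using eqs(1) nrm_eq_0_iff[of "v - G u"] uv by simp
    have "(lam 1)\<^sup>2 * (lam 1)\<^sup>2 \<le> (lam 1)\<^sup>2 * Re (cip H u (G u))"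
      using sq(1)[OF uv(1,2)] eqs(2) by (simp add: power2_eq_square)
    then have ge: "(lam 1)\<^sup>2 \<le> Re (cip H u (G u))" using pos by (subst (asm) mult_le_cancel_left_pos)
    note kb = maximizer_unique[OF simple uv(1,2) ge]
    have "A f = ?T f" if f: "f \<in> vecs H" for f
    proof -
      have "A f = ketbra H u u (G f)"
        using uv f by (simp add: v ketbra_def frame_op_selfadjoint)
      also have "\<dots> = ketbra H (\<phi> 1) (\<phi> 1) (G f)" by (rule kb) simp
      also have "\<dots> = ?T f"
        using f \<phi>1 by (simp add: ketbra_def G1 cip_scal_left del: One_nat_def flip: frame_op_selfadjoint)
      finally show ?thesis .
    qed
    then show ?thesis by (simp add: op_eq_def)
  qed
  have "is_arg_min ?J ?P ?T"
    unfolding is_arg_min_def using P le by (meson not_le)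
  moreover have "op_eq H A ?T" if "top_eigenvalue_simple N lam" and A: "is_arg_min ?J ?P A" for A
  proof (rule uniq[OF that(1)])
    show "?P A" using A unfolding is_arg_min_def by (rule conjunct1)
    have "\<not> ?J ?T < ?J A" using A P unfolding is_arg_min_def by blast
    then show "?J A \<le> ?J ?T" by (rule leI)
  qed
  ultimately show ?thesis unfolding realizes_min_def by blast
qed

end

theorem lemma2p9:
  fixes K :: "complex ^ 'm \<Rightarrow> complex ^ 'm \<Rightarrow> complex"
    and \<Phi> :: "complex ^ 'm \<Rightarrow> (complex ^ 'm \<Rightarrow> complex)"
    and x :: "'n::finite \<Rightarrow> complex ^ 'm"
    and N :: enat
    and lam :: "nat \<Rightarrow> real"
    and \<phi> :: "nat \<Rightarrow> (complex ^ 'm \<Rightarrow> complex)"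
  assumes "pos_def_kernel K"
    and "feature_map K \<Phi>"
    and "N \<ge> 1"
    and "spectral_representation (rkhs K) (frame_op (rkhs K) \<Phi> x) N lam \<phi>"
  shows
    "let H = rkhs K;
         PhiX = synthesis_op H \<Phi> x;
         G = frame_op H \<Phi> x;
         simple = top_eigenvalue_simple N lam;
         admissible = (\<lambda>Q. (hs_norm H H Q)\<^sup>2 = 1 \<and> selfadjoint_projection H Q)
     in op_eq H G (\<lambda>f. \<Sum>j\<in>UNIV. ketbra H (\<Phi> (x j)) (\<Phi> (x j)) f) \<and>
        op_eq H G (PhiX \<circ> adj Cn H PhiX) \<and>
        realizes_max H simple (\<lambda>Q. (hs_norm Cn H (Q \<circ> PhiX))\<^sup>2) admissible
          (ketbra H (\<phi> 1) (\<phi> 1)) \<and>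
        realizes_max H simple (\<lambda>Q. Re (op_trace H (Q \<circ> G))) admissible
          (ketbra H (\<phi> 1) (\<phi> 1)) \<and>
        realizes_min H simple (\<lambda>A. hs_norm H H (\<lambda>f. G f - A f))
          (\<lambda>A. bounded_op H H A \<and> rank_le_one H H A)
          (\<lambda>f. scal H (of_real ((lam 1)\<^sup>2)) (ketbra H (\<phi> 1) (\<phi> 1) f))"
proof -
  interpret positive_definite_kernel K by unfold_locales (rule assms(1))
  interpret hilbert_space "rkhs K" by (rule hilbert_space_rkhs)
  interpret spectral_frame "rkhs K" \<Phi> x N lam \<phi>
    using assms(2-4) by unfold_locales (auto simp: feature_map_def)
  have "op_eq (rkhs K) (frame_op (rkhs K) \<Phi> x) (\<lambda>f. \<Sum>j\<in>UNIV. ketbra (rkhs K) (\<Phi> (x j)) (\<Phi> (x j)) f)"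
    by (simp only: op_eq_def frame_op_sum) simp
  moreover have "op_eq (rkhs K) (frame_op (rkhs K) \<Phi> x)
      (synthesis_op (rkhs K) \<Phi> x \<circ> adj Cn (rkhs K) (synthesis_op (rkhs K) \<Phi> x))"
    by (simp add: op_eq_def frame_op_eq adj_synthesis_op)
  ultimately show ?thesis
    unfolding Let_def
    by (intro conjI realizes_max_top_projection realizes_min_top_truncation
        hs_norm_projected_synthesis arg_cong[where f = Re] op_trace_projected_frame)
qed

end
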